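(* Let $T$ be a tree chosen uniformly at random among all $n^{n-2}$ trees on the vertex set $[n]$. Then with probability $1-o(1)$ as $n\to\infty$, $$D(T)\ge(1-o(1))\Delta(T)=(1-o(1))\frac{\ln n}{\ln\ln n},$$ where $\Delta(T)$ is the maximum degree of $T$.
   Context: First order sentences about graphs use variables ranging over vertices, connectives, quantifiers, equality and adjacency. $D(G)$ is the smallest quantifier depth of a first order sentence which is true in $G$ and false in every graph not isomorphic to $G$. *)

theory Defs
  imports "HOL-Probability.Probability" "Graph_Theory.Graph_Theory"
begin

text \<open>
  Graphs are finite simple undirected graphs, in the form of the library locale
  \<^locale>\<open>pair_graph\<close>: an undirected edge \<open>uv\<close> is the pair of arcs \<open>(u,v)\<close>, \<open>(v,u)\<close>.
\<close>

text \<open>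
  The library predicate \<^const>\<open>tree\<close> does not mean \<open>tree\<close> in this representation: it excludes
  all directed cycles, and \<open>(u,v), (v,u)\<close> is a directed cycle. The cycles of an undirected graph
  are the directed ones of length at least three.
\<close>

definition undirected_tree :: "'a pair_pre_digraph \<Rightarrow> bool" where
  "undirected_tree G \<longleftrightarrow>
     pair_graph G \<and>
     Digraph_Component.connected (with_proj G) \<and>
     \<not> (\<exists>p. pre_digraph.cycle (with_proj G) p \<and> 3 \<le> length p)"

definition labelled_trees :: "nat \<Rightarrow> nat pair_pre_digraph set" where
  "labelled_trees n = {T. undirected_tree T \<and> pverts T = {1..n}}"

definition random_tree :: "nat \<Rightarrow> nat pair_pre_digraph pmf" where
  "random_tree n = pmf_of_set (labelled_trees n)"

text \<open>By symmetry, the out-degree of a vertex is its number of neighbours.\<close>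

definition max_degree :: "'a pair_pre_digraph \<Rightarrow> nat" where
  "max_degree G = Max (out_degree (with_proj G) ` pverts G)"

datatype fo =
    Eq nat nat
  | Adj nat nat
  | Neg fo
  | Conj fo fo
  | Disj fo fo
  | Impl fo fo
  | Exi nat fo
  | All nat fo

fun free_vars :: "fo \<Rightarrow> nat set" where
  "free_vars (Eq x y) = {x, y}"
| "free_vars (Adj x y) = {x, y}"
| "free_vars (Neg \<phi>) = free_vars \<phi>"
| "free_vars (Conj \<phi> \<psi>) = free_vars \<phi> \<union> free_vars \<psi>"
| "free_vars (Disj \<phi> \<psi>) = free_vars \<phi> \<union> free_vars \<psi>"
| "free_vars (Impl \<phi> \<psi>) = free_vars \<phi> \<union> free_vars \<psi>"
| "free_vars (Exi x \<phi>) = free_vars \<phi> - {x}"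
| "free_vars (All x \<phi>) = free_vars \<phi> - {x}"

definition sentence :: "fo \<Rightarrow> bool" where
  "sentence \<phi> \<longleftrightarrow> free_vars \<phi> = {}"

fun quantifier_depth :: "fo \<Rightarrow> nat" where
  "quantifier_depth (Eq x y) = 0"
| "quantifier_depth (Adj x y) = 0"
| "quantifier_depth (Neg \<phi>) = quantifier_depth \<phi>"
| "quantifier_depth (Conj \<phi> \<psi>) = max (quantifier_depth \<phi>) (quantifier_depth \<psi>)"
| "quantifier_depth (Disj \<phi> \<psi>) = max (quantifier_depth \<phi>) (quantifier_depth \<psi>)"
| "quantifier_depth (Impl \<phi> \<psi>) = max (quantifier_depth \<phi>) (quantifier_depth \<psi>)"
| "quantifier_depth (Exi x \<phi>) = Suc (quantifier_depth \<phi>)"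
| "quantifier_depth (All x \<phi>) = Suc (quantifier_depth \<phi>)"

fun sat :: "'a pair_pre_digraph \<Rightarrow> (nat \<Rightarrow> 'a) \<Rightarrow> fo \<Rightarrow> bool" where
  "sat G e (Eq x y) \<longleftrightarrow> e x = e y"
| "sat G e (Adj x y) \<longleftrightarrow> (e x, e y) \<in> parcs G"
| "sat G e (Neg \<phi>) \<longleftrightarrow> \<not> sat G e \<phi>"
| "sat G e (Conj \<phi> \<psi>) \<longleftrightarrow> sat G e \<phi> \<and> sat G e \<psi>"
| "sat G e (Disj \<phi> \<psi>) \<longleftrightarrow> sat G e \<phi> \<or> sat G e \<psi>"
| "sat G e (Impl \<phi> \<psi>) \<longleftrightarrow> (sat G e \<phi> \<longrightarrow> sat G e \<psi>)"
| "sat G e (Exi x \<phi>) \<longleftrightarrow> (\<exists>v\<in>pverts G. sat G (e(x := v)) \<phi>)"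
| "sat G e (All x \<phi>) \<longleftrightarrow> (\<forall>v\<in>pverts G. sat G (e(x := v)) \<phi>)"

text \<open>
  The truth value of a sentence does not depend on the assignment, so for sentences
  \<open>\<not> true_in G \<phi>\<close> says that \<open>\<phi>\<close> is false in \<open>G\<close>.
\<close>

definition true_in :: "'a pair_pre_digraph \<Rightarrow> fo \<Rightarrow> bool" where
  "true_in G \<phi> \<longleftrightarrow> (\<forall>e. sat G e \<phi>)"

lemma sat_cong_free_vars:
  "(\<And>x. x \<in> free_vars \<phi> \<Longrightarrow> e x = e' x) \<Longrightarrow> sat G e \<phi> \<longleftrightarrow> sat G e' \<phi>"
proof (induction \<phi> arbitrary: e e')
  case (Exi x \<phi>)
  have "sat G (e(x := v)) \<phi> \<longleftrightarrow> sat G (e'(x := v)) \<phi>" for v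
    by (rule Exi.IH) (use Exi.prems in auto)
  then show ?case by simp
next
  case (All x \<phi>)
  have "sat G (e(x := v)) \<phi> \<longleftrightarrow> sat G (e'(x := v)) \<phi>" for v
    by (rule All.IH) (use All.prems in auto)
  then show ?case by simp
next
  case (Conj \<phi> \<psi>)
  have "sat G e \<phi> \<longleftrightarrow> sat G e' \<phi>"
    by (rule Conj.IH(1)) (use Conj.prems in simp)
  moreover have "sat G e \<psi> \<longleftrightarrow> sat G e' \<psi>"
    by (rule Conj.IH(2)) (use Conj.prems in simp)
  ultimately show ?case by simp
next
  case (Disj \<phi> \<psi>)
  have "sat G e \<phi> \<longleftrightarrow> sat G e' \<phi>"
    by (rule Disj.IH(1)) (use Disj.prems in simp)
  moreover have "sat G e \<psi> \<longleftrightarrow> sat G e' \<psi>"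
    by (rule Disj.IH(2)) (use Disj.prems in simp)
  ultimately show ?case by simp
next
  case (Impl \<phi> \<psi>)
  have "sat G e \<phi> \<longleftrightarrow> sat G e' \<phi>"
    by (rule Impl.IH(1)) (use Impl.prems in simp)
  moreover have "sat G e \<psi> \<longleftrightarrow> sat G e' \<psi>"
    by (rule Impl.IH(2)) (use Impl.prems in simp)
  ultimately show ?case by simp
next
  case (Neg \<phi>)
  have "sat G e \<phi> \<longleftrightarrow> sat G e' \<phi>"
    by (rule Neg.IH) (use Neg.prems in simp)
  then show ?case by simp
qed simp_all

lemma true_in_sentence:
  "sentence \<phi> \<Longrightarrow> true_in G \<phi> \<longleftrightarrow> sat G e \<phi>"
  unfolding true_in_def sentence_def
  by (rule iffI, erule spec, rule allI) (erule iffD1[OF sat_cong_free_vars, rotated], simp)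

text \<open>
  Every finite graph is isomorphic to one with vertices in \<^typ>\<open>nat\<close>, so \<open>H\<close> below ranges over all
  graphs up to isomorphism.
\<close>

definition defines_graph :: "fo \<Rightarrow> 'a pair_pre_digraph \<Rightarrow> bool" where
  "defines_graph \<phi> G \<longleftrightarrow>
     sentence \<phi> \<and> true_in G \<phi> \<and>
     (\<forall>H :: nat pair_pre_digraph.
        pair_graph H \<and> \<not> digraph_iso (with_proj G) (with_proj H) \<longrightarrow> \<not> true_in H \<phi>)"

text \<open>
  A finite graph with \<open>n\<close> vertices is defined by a sentence of quantifier depth \<open>n + 1\<close>, so the
  minimum exists.
\<close>

definition logical_depth :: "'a pair_pre_digraph \<Rightarrow> nat" where
  "logical_depth G = (LEAST d. \<exists>\<phi>. defines_graph \<phi> G \<and> quantifier_depth \<phi> = d)"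

end

theory Submission
  imports Defs "HOL-Real_Asymp.Real_Asymp"
begin

text \<open>
  A rooted tree on \<open>V\<close> is a function sending every vertex to its parent and the root to itself. If a
  rooted forest has \<open>m\<close> roots, it extends to exactly \<open>n ^ (m - 1)\<close> rooted trees: count in two ways
  the pairs of an extension and a root of the forest that is no longer a root. So \<open>k\<close> given
  vertices are all children of a given vertex with probability \<open>n ^ (- k)\<close>, and the first moment
  bounds the maximum degree from above. Deleting \<open>k\<close> leaves shows that \<open>k\<close> given vertices are all
  leaves hanging from a given vertex with probability \<open>(n - k) ^ (n - k - 1) / n ^ (n - 1)\<close>, and the
  second moment gives a vertex with at least \<open>k\<close> leaves, for \<open>k\<close> up to
  \<open>(1 - o(1)) ln n / ln (ln n)\<close>. One more leaf at such a vertex cannot be noticed by a sentence of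
  quantifier depth at most \<open>k\<close>, since within \<open>k\<close> rounds of the Ehrenfeucht-Fraisse game the
  duplicator always has an unused leaf.
\<close>

section \<open>Rooted trees as parent functions\<close>

definition roots :: "'a set \<Rightarrow> ('a \<Rightarrow> 'a) \<Rightarrow> 'a set" where
  "roots V f = {x \<in> V. f x = x}"

definition parent_forests :: "'a set \<Rightarrow> ('a \<Rightarrow> 'a) set" where
  "parent_forests V = {f \<in> V \<rightarrow>\<^sub>E V. \<forall>x\<in>V. \<exists>i. f ((f ^^ i) x) = (f ^^ i) x}"

definition parent_trees :: "'a set \<Rightarrow> ('a \<Rightarrow> 'a) set" where
  "parent_trees V = {f \<in> parent_forests V. \<exists>r. roots V f = {r}}"

definition tree_extensions :: "'a set \<Rightarrow> ('a \<Rightarrow> 'a) \<Rightarrow> ('a \<Rightarrow> 'a) set" where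
  "tree_extensions V g = {f \<in> parent_trees V. \<forall>x\<in>V. g x \<noteq> x \<longrightarrow> f x = g x}"

definition root_of :: "('a \<Rightarrow> 'a) \<Rightarrow> 'a \<Rightarrow> 'a" where
  "root_of f x = (f ^^ (LEAST i. f ((f ^^ i) x) = (f ^^ i) x)) x"

lemma funpow_mem:
  assumes "\<And>x. x \<in> V \<Longrightarrow> f x \<in> V" "x \<in> V"
  shows "(f ^^ i) x \<in> V"
  by (induction i) (auto simp: assms)

lemma parent_forests_mem: "f \<in> parent_forests V \<Longrightarrow> x \<in> V \<Longrightarrow> f x \<in> V"
  by (auto simp: parent_forests_def)

lemma parent_forests_funpow_mem: "f \<in> parent_forests V \<Longrightarrow> x \<in> V \<Longrightarrow> (f ^^ i) x \<in> V"
  by (rule funpow_mem) (auto simp: parent_forests_mem)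

lemma parent_trees_forest: "f \<in> parent_trees V \<Longrightarrow> f \<in> parent_forests V"
  by (auto simp: parent_trees_def)

lemma funpow_fixed: "f r = r \<Longrightarrow> (f ^^ i) r = r"
  by (induction i) auto

lemma funpow_fixed_ge:
  assumes "f ((f ^^ i) x) = (f ^^ i) x" "i \<le> j"
  shows "(f ^^ j) x = (f ^^ i) x"
proof -
  have "(f ^^ j) x = (f ^^ (j - i)) ((f ^^ i) x)"
    using assms(2) by (metis comp_apply funpow_add le_add_diff_inverse2)
  then show ?thesis using funpow_fixed[of f "(f ^^ i) x"] assms(1) by simp
qed

lemma root_of_reached:
  assumes "f \<in> parent_forests V" "x \<in> V"
  obtains i where "root_of f x = (f ^^ i) x" "f (root_of f x) = root_of f x"
    "\<And>j. j < i \<Longrightarrow> f ((f ^^ j) x) \<noteq> (f ^^ j) x"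
proof
  let ?P = "\<lambda>i. f ((f ^^ i) x) = (f ^^ i) x"
  show "root_of f x = (f ^^ (LEAST i. ?P i)) x" by (simp add: root_of_def)
  have "\<exists>i. ?P i" using assms by (auto simp: parent_forests_def)
  then show "f (root_of f x) = root_of f x"
    unfolding root_of_def by (rule LeastI_ex)
  show "f ((f ^^ j) x) \<noteq> (f ^^ j) x" if "j < (LEAST i. ?P i)" for j
    using not_less_Least[OF that] .
qed

lemma root_of_in_roots:
  assumes "f \<in> parent_forests V" "x \<in> V"
  shows "root_of f x \<in> roots V f"
proof -
  obtain i where "root_of f x = (f ^^ i) x" "f (root_of f x) = root_of f x"
    using root_of_reached[OF assms] by metis
  then show ?thesis using parent_forests_funpow_mem[OF assms] by (auto simp: roots_def)
qed

lemma root_of_root: "f x = x \<Longrightarrow> root_of f x = x"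
  by (simp add: root_of_def funpow_fixed)

lemma parent_forests_acyclic:
  assumes "f \<in> parent_forests V" "x \<in> V" "(f ^^ Suc i) x = x"
  shows "f x = x"
proof -
  obtain j where j: "f ((f ^^ j) x) = (f ^^ j) x"
    using assms by (auto simp: parent_forests_def)
  have "(f ^^ (Suc i * k)) x = x" for k
  proof (induction k)
    case (Suc k)
    have "(f ^^ (Suc i * Suc k)) x = (f ^^ Suc i) ((f ^^ (Suc i * k)) x)"
      by (metis comp_apply funpow_add mult_Suc_right)
    then show ?case using Suc assms(3) by metis
  qed simp
  moreover have "(f ^^ (Suc i * j)) x = (f ^^ j) x"
    by (rule funpow_fixed_ge[OF j]) simp
  ultimately show ?thesis using j by metis
qed

lemma funpow_agree_root:
  assumes "g \<in> parent_forests V" "u \<in> V"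
    and agree: "\<And>y. y \<in> V \<Longrightarrow> g y \<noteq> y \<Longrightarrow> f y = g y"
  shows "\<exists>i. (f ^^ i) u = root_of g u"
proof -
  obtain i where i: "root_of g u = (g ^^ i) u" "\<And>j. j < i \<Longrightarrow> g ((g ^^ j) u) \<noteq> (g ^^ j) u"
    using root_of_reached[OF assms(1,2)] by metis
  have "j \<le> i \<Longrightarrow> (f ^^ j) u = (g ^^ j) u" for j
  proof (induction j)
    case (Suc j)
    then show ?case
      using i(2)[of j] agree[of "(g ^^ j) u"] parent_forests_funpow_mem[OF assms(1,2)] by simp
  qed simp
  then show ?thesis using i(1) by auto
qed

lemma parent_forests_update:
  assumes g: "g \<in> parent_forests V" and x: "x \<in> roots V g" and u: "u \<in> V" "root_of g u \<noteq> x"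
  shows "g(x := u) \<in> parent_forests V" and "roots V (g(x := u)) = roots V g - {x}"
proof -
  let ?h = "g(x := u)"
  have xV: "x \<in> V" "g x = x" using x by (auto simp: roots_def)
  have "u \<noteq> x" using u(2) root_of_root xV by metis
  then show "roots V ?h = roots V g - {x}" by (auto simp: roots_def)
  have agree: "?h y = g y" if "y \<in> V" "g y \<noteq> y" for y
    using that xV by auto
  have reach: "\<exists>i. (?h ^^ i) y = root_of g y" if "y \<in> V" for y
    by (rule funpow_agree_root[OF g that agree])
  have fixed: "?h (root_of g y) = root_of g y" if "y \<in> V" "root_of g y \<noteq> x" for y
    using root_of_in_roots[OF g that(1)] that by (auto simp: roots_def)
  have "\<exists>i. ?h ((?h ^^ i) y) = (?h ^^ i) y" if y: "y \<in> V" for y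
  proof (cases "root_of g y = x")
    case False
    then show ?thesis using reach[OF y] fixed[OF y] by metis
  next
    case True
    obtain i where i: "(?h ^^ i) y = x" using reach[OF y] True by auto
    obtain j where j: "(?h ^^ j) u = root_of g u" using reach[OF u(1)] by auto
    have "(?h ^^ Suc i) y = u" using i by simp
    then have "(?h ^^ (j + Suc i)) y = root_of g u"
      using j by (simp only: funpow_add comp_apply)
    then show ?thesis using fixed[OF u] by metis
  qed
  moreover have "?h \<in> V \<rightarrow>\<^sub>E V" using g u xV by (auto simp: parent_forests_def PiE_iff extensional_def)
  ultimately show "?h \<in> parent_forests V" by (simp add: parent_forests_def)
qed

lemma finite_parent_trees: "finite V \<Longrightarrow> finite (parent_trees V)"
  by (rule finite_subset[of _ "V \<rightarrow>\<^sub>E V"]) (auto simp: parent_trees_def parent_forests_def intro: finite_PiE)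

lemma finite_tree_extensions: "finite V \<Longrightarrow> finite (tree_extensions V g)"
  by (simp add: tree_extensions_def finite_parent_trees)

lemma tree_extension_no_backward_edge:
  assumes "g \<in> parent_forests V" "f \<in> tree_extensions V g" "x \<in> roots V g"
  shows "f x \<noteq> x \<longleftrightarrow> root_of g (f x) \<noteq> x"
proof
  have f: "f \<in> parent_forests V" using assms(2) by (auto simp: tree_extensions_def parent_trees_def)
  have xV: "x \<in> V" "g x = x" using assms(3) by (auto simp: roots_def)
  show "root_of g (f x) \<noteq> x" if "f x \<noteq> x"
  proof
    assume *: "root_of g (f x) = x"
    have "\<exists>i. (f ^^ i) (f x) = root_of g (f x)"
      by (rule funpow_agree_root[OF assms(1)])
        (use assms(2) parent_forests_mem[OF f xV(1)] in \<open>auto simp: tree_extensions_def\<close>)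
    then obtain i where "(f ^^ Suc i) x = x" using * by (metis comp_apply funpow_Suc_right)
    then show False using parent_forests_acyclic[OF f xV(1)] that by blast
  qed
  show "f x \<noteq> x" if "root_of g (f x) \<noteq> x"
    using that root_of_root[of g x] xV by auto
qed

lemma tree_extensions_update:
  assumes "g \<in> parent_forests V" "x \<in> roots V g" "u \<in> V" "root_of g u \<noteq> x"
  shows "tree_extensions V (g(x := u)) = {f \<in> tree_extensions V g. f x = u}"
proof -
  have xV: "x \<in> V" "g x = x" using assms(2) by (auto simp: roots_def)
  have "u \<noteq> x" using assms(4) root_of_root xV by metis
  then show ?thesis using xV by (auto simp: tree_extensions_def)
qed

lemma tree_extension_card_nonroots:
  assumes "finite V" "g \<in> parent_forests V" "f \<in> tree_extensions V g"
  shows "card {x \<in> roots V g. f x \<noteq> x} = card (roots V g) - 1"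
proof -
  have "roots V f \<subseteq> roots V g" using assms(3) by (auto simp: roots_def tree_extensions_def)
  moreover obtain r where "roots V f = {r}"
    using assms(3) by (auto simp: tree_extensions_def parent_trees_def)
  ultimately have "{x \<in> roots V g. f x \<noteq> x} = roots V g - {r}" "r \<in> roots V g"
    by (auto simp: roots_def)
  then show ?thesis using assms(1) by (simp add: roots_def)
qed

theorem card_tree_extensions:
  assumes "finite V" "g \<in> parent_forests V" "card (roots V g) = Suc m"
  shows "card (tree_extensions V g) = card V ^ m"
  using assms(2,3)
proof (induction m arbitrary: g)
  case 0
  then obtain r where r: "roots V g = {r}" by (auto simp: card_1_singleton_iff)
  have "f = g" if f: "f \<in> tree_extensions V g" for f
  proof -
    have "roots V f \<subseteq> roots V g" "roots V f \<noteq> {}"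
      using f by (auto simp: roots_def tree_extensions_def parent_trees_def)
    then have "f r = r" "g r = r" using r by (auto simp: roots_def)
    then have "f y = g y" if "y \<in> V" for y
      using f that r by (cases "y = r") (auto simp: tree_extensions_def roots_def)
    then show ?thesis using f 0(1) 
      by (auto simp: tree_extensions_def parent_trees_def parent_forests_def intro: PiE_ext)
  qed
  moreover have "g \<in> tree_extensions V g"
    using 0 r by (auto simp: tree_extensions_def parent_trees_def)
  ultimately have "tree_extensions V g = {g}" by auto
  then show ?case by simp
next
  case (Suc m)
  let ?E = "tree_extensions V g" and ?R = "roots V g" and ?n = "card V"
  have finE: "finite ?E" using finite_tree_extensions assms(1) by blast
  have finR: "finite ?R" using assms(1) by (simp add: roots_def)
  have fV: "f x \<in> V" if "f \<in> ?E" "x \<in> ?R" for f x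
    using that parent_forests_mem[of f V x] by (auto simp: tree_extensions_def roots_def parent_trees_def)
  have inner: "(\<Sum>u\<in>V. of_bool (f x = u \<and> root_of g u \<noteq> x)) = (of_bool (f x \<noteq> x) :: nat)"
    if "f \<in> ?E" "x \<in> ?R" for f x
  proof -
    have "(\<Sum>u\<in>V. of_bool (f x = u \<and> root_of g u \<noteq> x))
        = (\<Sum>u\<in>V. if f x = u then of_bool (root_of g (f x) \<noteq> x) else (0::nat))"
      by (rule sum.cong) auto
    also have "\<dots> = of_bool (f x \<noteq> x)"
      using fV[OF that] assms(1) tree_extension_no_backward_edge[OF Suc.prems(1) that] by simp
    finally show ?thesis .
  qed
  have card_update: "(\<Sum>f\<in>?E. of_bool (f x = u \<and> root_of g u \<noteq> x)) =
      of_bool (root_of g u \<noteq> x) * ?n ^ m" if "u \<in> V" "x \<in> ?R" for u x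
  proof (cases "root_of g u \<noteq> x")
    case True
    have "(\<Sum>f\<in>?E. of_bool (f x = u \<and> root_of g u \<noteq> x)) = (\<Sum>f\<in>?E. of_bool (f x = u))"
      using True by (auto intro: sum.cong)
    also have "\<dots> = card {f \<in> ?E. f x = u}" using finE by (simp add: Int_def conj_commute)
    also have "\<dots> = card (tree_extensions V (g(x := u)))"
      using tree_extensions_update[OF Suc.prems(1) that(2) that(1) True] by simp
    also have "\<dots> = ?n ^ m"
    proof (rule Suc.IH)
      show "g(x := u) \<in> parent_forests V"
        by (rule parent_forests_update(1)[OF Suc.prems(1) that(2) that(1) True])
      show "card (roots V (g(x := u))) = Suc m"
        using parent_forests_update(2)[OF Suc.prems(1) that(2) that(1) True] Suc.prems(2) finR that(2)
        by simp
    qed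
    finally show ?thesis using True by simp
  qed simp
  have "Suc m * card ?E = (\<Sum>f\<in>?E. card {x \<in> ?R. f x \<noteq> x})"
    using tree_extension_card_nonroots[OF assms(1) Suc.prems(1)] Suc.prems(2) by simp
  also have "\<dots> = (\<Sum>f\<in>?E. \<Sum>x\<in>?R. of_bool (f x \<noteq> x))"
    using finR by (intro sum.cong) (auto simp: Int_def conj_commute)
  also have "\<dots> = (\<Sum>f\<in>?E. \<Sum>x\<in>?R. \<Sum>u\<in>V. of_bool (f x = u \<and> root_of g u \<noteq> x))"
    by (intro sum.cong refl) (simp add: inner)
  also have "\<dots> = (\<Sum>f\<in>?E. \<Sum>u\<in>V. \<Sum>x\<in>?R. of_bool (f x = u \<and> root_of g u \<noteq> x))"
    by (intro sum.cong refl sum.swap)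
  also have "\<dots> = (\<Sum>u\<in>V. \<Sum>x\<in>?R. \<Sum>f\<in>?E. of_bool (f x = u \<and> root_of g u \<noteq> x))"
    by (subst sum.swap, intro sum.cong refl sum.swap)
  also have "\<dots> = (\<Sum>u\<in>V. \<Sum>x\<in>?R. of_bool (root_of g u \<noteq> x) * ?n ^ m)"
    by (intro sum.cong refl) (simp add: card_update del: sum_of_bool_eq)
  also have "\<dots> = (\<Sum>u\<in>V. Suc m * ?n ^ m)"
  proof (intro sum.cong refl)
    fix u assume "u \<in> V"
    have "(\<Sum>x\<in>?R. of_bool (root_of g u \<noteq> x)) = card (?R - {root_of g u})"
      using finR by (simp add: set_diff_eq Int_def conj_commute eq_commute)
    also have "\<dots> = Suc m"
      using root_of_in_roots[OF Suc.prems(1) \<open>u \<in> V\<close>] finR Suc.prems(2) by simp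
    finally show "(\<Sum>x\<in>?R. of_bool (root_of g u \<noteq> x) * ?n ^ m) = Suc m * ?n ^ m"
      by (simp only: sum_distrib_right[symmetric])
  qed
  finally have "Suc m * card ?E = Suc m * (?n ^ Suc m)" by (simp add: algebra_simps)
  then show ?case using Suc_mult_cancel1 by blast
qed

corollary card_parent_trees:
  assumes "finite V" "V \<noteq> {}"
  shows "card (parent_trees V) = card V ^ (card V - 1)"
proof -
  define g where "g = restrict (\<lambda>x. x) V"
  have "g \<in> parent_forests V"
    by (auto simp: parent_forests_def g_def intro!: exI[of _ 0])
  moreover have "roots V g = V" by (auto simp: roots_def g_def)
  moreover have "tree_extensions V g = parent_trees V" by (auto simp: tree_extensions_def g_def)
  ultimately show ?thesis
    using card_tree_extensions[of V g "card V - 1"] assms by (simp add: card_gt_0_iff)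
qed

corollary card_parent_trees_star:
  assumes "finite V" "v \<in> V" "S \<subseteq> V - {v}"
  shows "card {f \<in> parent_trees V. \<forall>s\<in>S. f s = v} = card V ^ (card V - card S - 1)"
proof -
  define g where "g = restrict (\<lambda>x. if x \<in> S then v else x) V"
  have "g ((g ^^ 1) x) = (g ^^ 1) x" if "x \<in> V" for x
    using that assms by (auto simp: g_def)
  moreover have "g \<in> V \<rightarrow>\<^sub>E V" using assms(2) by (auto simp: g_def)
  ultimately have "g \<in> parent_forests V"
    unfolding parent_forests_def by blast
  moreover have "roots V g = V - S" using assms by (auto simp: roots_def g_def)
  moreover have "tree_extensions V g = {f \<in> parent_trees V. \<forall>s\<in>S. f s = v}"
    using assms(2,3) by (auto simp: tree_extensions_def g_def)
  moreover have "card (V - S) = Suc (card V - card S - 1)"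
  proof -
    have "finite S" using assms finite_subset by blast
    moreover have "card S < card V" using assms by (intro psubset_card_mono) auto
    ultimately show ?thesis using assms by (subst card_Diff_subset) auto
  qed
  ultimately show ?thesis
    using card_tree_extensions[of V g "card V - card S - 1"] assms by simp
qed

section \<open>Moments of the number of leaf bundles\<close>

definition leaf_children :: "'a set \<Rightarrow> ('a \<Rightarrow> 'a) \<Rightarrow> 'a \<Rightarrow> 'a set" where
  "leaf_children V f v = {s \<in> V. f s = v \<and> s \<notin> f ` V}"

lemma parent_trees_restrict:
  assumes f: "f \<in> parent_trees V" and S: "\<And>s. s \<in> S \<Longrightarrow> s \<notin> f ` V"
  shows "restrict f (V - S) \<in> parent_trees (V - S)"
proof -
  let ?h = "restrict f (V - S)"
  have forest: "f \<in> parent_forests V" using f by (rule parent_trees_forest)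
  have closed: "f x \<in> V - S" if "x \<in> V" for x
    using that S parent_forests_mem[OF forest] by auto
  have iter: "(?h ^^ i) x = (f ^^ i) x \<and> (f ^^ i) x \<in> V - S" if "x \<in> V - S" for i x
    using that by (induction i) (use closed in auto)
  have "\<exists>i. ?h ((?h ^^ i) x) = (?h ^^ i) x" if x: "x \<in> V - S" for x
  proof -
    obtain i where "f ((f ^^ i) x) = (f ^^ i) x" using forest x by (auto simp: parent_forests_def)
    moreover have "(?h ^^ Suc i) x = (f ^^ Suc i) x" "(?h ^^ i) x = (f ^^ i) x" using iter[OF x] by blast+
    ultimately show ?thesis by (intro exI[of _ i]) (metis comp_apply funpow.simps(2))
  qed
  moreover have "?h \<in> (V - S) \<rightarrow>\<^sub>E (V - S)" using closed by auto
  moreover have "roots (V - S) ?h = roots V f"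
    using S rev_image_eqI[of _ V _ f] by (fastforce simp: roots_def)
  ultimately show ?thesis using f by (auto simp: parent_trees_def parent_forests_def)
qed

lemma parent_trees_attach:
  assumes h: "h \<in> parent_trees (V - S)" and S: "S \<subseteq> V" and c: "\<And>s. s \<in> S \<Longrightarrow> c s \<in> V - S"
  defines "f \<equiv> \<lambda>x. if x \<in> S then c x else h x"
  shows "f \<in> parent_trees V" and "\<And>x. x \<in> V \<Longrightarrow> f x \<in> V - S"
proof -
  have forest: "h \<in> parent_forests (V - S)" using h by (rule parent_trees_forest)
  have iter: "(f ^^ i) x = (h ^^ i) x \<and> (h ^^ i) x \<in> V - S" if "x \<in> V - S" for i x
    using that by (induction i) (use parent_forests_mem[OF forest] in \<open>auto simp: f_def\<close>)
  have reach: "\<exists>i. f ((f ^^ i) x) = (f ^^ i) x" if x: "x \<in> V - S" for x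
  proof -
    obtain i where "h ((h ^^ i) x) = (h ^^ i) x" using forest x by (auto simp: parent_forests_def)
    then show ?thesis using iter[OF x] by (intro exI[of _ i]) (simp add: f_def)
  qed
  show closed: "f x \<in> V - S" if "x \<in> V" for x
    using that c parent_forests_mem[OF forest] by (auto simp: f_def)
  have "\<exists>i. f ((f ^^ i) x) = (f ^^ i) x" if x: "x \<in> V" for x
  proof -
    obtain i where "f ((f ^^ i) (f x)) = (f ^^ i) (f x)" using reach[OF closed[OF x]] by blast
    then show ?thesis by (intro exI[of _ "Suc i"]) (simp only: funpow_Suc_right comp_apply)
  qed
  moreover have "f \<in> V \<rightarrow>\<^sub>E V"
    using closed forest S by (auto simp: PiE_iff extensional_def f_def parent_forests_def)
  moreover have "c s \<noteq> s" if "s \<in> S" for s using c[OF that] that by auto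
  then have "roots V f = roots (V - S) h"
    by (auto simp: roots_def f_def)
  ultimately show "f \<in> parent_trees V"
    using h by (auto simp: parent_trees_def parent_forests_def)
qed

lemma card_parent_trees_leaves:
  assumes S: "S \<subseteq> V" and c: "\<And>s. s \<in> S \<Longrightarrow> c s \<in> V - S"
  shows "card {f \<in> parent_trees V. \<forall>s\<in>S. f s = c s \<and> s \<notin> f ` V} = card (parent_trees (V - S))"
proof (rule bij_betw_same_card)
  let ?A = "{f \<in> parent_trees V. \<forall>s\<in>S. f s = c s \<and> s \<notin> f ` V}"
  let ?attach = "\<lambda>h x. if x \<in> S then c x else h x"
  show "bij_betw (\<lambda>f. restrict f (V - S)) ?A (parent_trees (V - S))"
  proof (rule bij_betw_byWitness[where f' = ?attach])
    show "\<forall>f\<in>?A. ?attach (restrict f (V - S)) = f"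
      using S by (auto simp: fun_eq_iff parent_trees_def parent_forests_def PiE_iff extensional_def)
    show "\<forall>h\<in>parent_trees (V - S). restrict (?attach h) (V - S) = h"
      by (auto simp: fun_eq_iff parent_trees_def parent_forests_def PiE_iff extensional_def)
    show "(\<lambda>f. restrict f (V - S)) ` ?A \<subseteq> parent_trees (V - S)"
      by (auto intro!: parent_trees_restrict)
    show "?attach ` parent_trees (V - S) \<subseteq> ?A"
    proof
      fix f assume "f \<in> ?attach ` parent_trees (V - S)"
      then obtain h where h: "h \<in> parent_trees (V - S)" and f: "f = ?attach h" by blast
      show "f \<in> ?A"
        using parent_trees_attach[OF h S c] unfolding f by fastforce
    qed
  qed
qed

lemma second_moment_count:
  fixes X :: "'a \<Rightarrow> real"
  assumes "finite T"
  shows "real (card {f \<in> T. X f = 0}) * (\<Sum>f\<in>T. X f)\<^sup>2 \<le>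
    real (card T) * (real (card T) * (\<Sum>f\<in>T. (X f)\<^sup>2) - (\<Sum>f\<in>T. X f)\<^sup>2)"
proof -
  let ?N = "real (card T)" and ?M = "\<Sum>f\<in>T. X f"
  have "real (card {f \<in> T. X f = 0}) * ?M\<^sup>2 = (\<Sum>f\<in>{f \<in> T. X f = 0}. ?M\<^sup>2)"
    by simp
  also have "\<dots> = (\<Sum>f\<in>{f \<in> T. X f = 0}. (?N * X f - ?M)\<^sup>2)"
    by (intro sum.cong) auto
  also have "\<dots> \<le> (\<Sum>f\<in>T. (?N * X f - ?M)\<^sup>2)"
    using assms by (intro sum_mono2) auto
  also have "\<dots> = (\<Sum>f\<in>T. ?N\<^sup>2 * (X f)\<^sup>2 - 2 * ?N * ?M * X f + ?M\<^sup>2)"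
    by (intro sum.cong refl) (simp add: power2_eq_square algebra_simps)
  also have "\<dots> = ?N\<^sup>2 * (\<Sum>f\<in>T. (X f)\<^sup>2) - 2 * ?N * ?M * ?M + ?N * ?M\<^sup>2"
    by (simp add: sum.distrib sum_subtractf sum_distrib_left[symmetric])
  also have "\<dots> = ?N * (?N * (\<Sum>f\<in>T. (X f)\<^sup>2) - ?M\<^sup>2)"
    by (simp add: algebra_simps power2_eq_square)
  finally show ?thesis .
qed

lemma sum_subsets_power_diff:
  fixes w :: real
  assumes "finite V" "S \<subseteq> V"
  shows "(\<Sum>S'\<in>Pow V. w ^ card (S' - S)) = 2 ^ card S * (1 + w) ^ (card V - card S)"
proof -
  let ?w = "\<lambda>x. if x \<in> S then 1 else w"
  have "w ^ card (S' - S) = prod ?w S' * prod (\<lambda>_. 1) (V - S')" if "S' \<in> Pow V" for S'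
  proof -
    have "finite S'" using that assms finite_subset by auto
    then have "prod ?w S' = prod (\<lambda>_. w) (S' - S)"
      by (intro prod.mono_neutral_cong_right) auto
    then show ?thesis by simp
  qed
  then have "(\<Sum>S'\<in>Pow V. w ^ card (S' - S)) = (\<Sum>S'\<in>Pow V. prod ?w S' * prod (\<lambda>_. 1) (V - S'))"
    by (rule sum.cong[OF refl])
  also have "\<dots> = (\<Prod>x\<in>V. ?w x + 1)" by (rule prod_add[OF assms(1), symmetric])
  also have "\<dots> = (\<Prod>x\<in>S. ?w x + 1) * (\<Prod>x\<in>V - S. ?w x + 1)"
    by (subst prod.subset_diff[OF assms(2,1)]) (rule mult.commute)
  also have "(\<Prod>x\<in>S. ?w x + 1) = (\<Prod>x\<in>S. 2)" by (rule prod.cong) auto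
  also have "(\<Prod>x\<in>V - S. ?w x + 1) = (\<Prod>x\<in>V - S. 1 + w)" by (rule prod.cong) auto
  also have "(\<Prod>x\<in>S. 2) * (\<Prod>x\<in>V - S. 1 + w) = 2 ^ card S * (1 + w) ^ (card V - card S)"
    using assms finite_subset[OF assms(2,1)] by (simp add: card_Diff_subset)
  finally show ?thesis .
qed

lemma leaf_children_parent: "s \<in> S \<Longrightarrow> S \<subseteq> leaf_children V f v \<Longrightarrow> v \<in> f ` V"
  by (auto simp: leaf_children_def)

lemma card_two_leaf_stars_le:
  assumes V: "finite V" and v: "v \<in> V" "w \<in> V" "v \<noteq> w"
    and S: "S \<subseteq> V" "S' \<subseteq> V" "card S = k" "card S' = k" "k > 0"
  shows "card {f \<in> parent_trees V. S \<subseteq> leaf_children V f v \<and> S' \<subseteq> leaf_children V f w} \<le>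
    (card V - 2 * k) ^ (card V - 2 * k - 1)" (is "card ?A \<le> _")
proof (cases "?A = {}")
  case False
  then obtain f where f: "S \<subseteq> leaf_children V f v" "S' \<subseteq> leaf_children V f w" by auto
  have "S \<noteq> {}" "S' \<noteq> {}" using S by auto
  then have img: "v \<in> f ` V" "w \<in> f ` V" using f leaf_children_parent by fast+
  then have notin: "v \<notin> S \<union> S'" "w \<notin> S \<union> S'" using f by (auto simp: leaf_children_def)
  have disj: "S \<inter> S' = {}" using f v(3) by (auto simp: leaf_children_def)
  let ?c = "\<lambda>s. if s \<in> S then v else w"
  have "S \<subseteq> leaf_children V f v \<longleftrightarrow> (\<forall>s\<in>S. f s = ?c s \<and> s \<notin> f ` V)" for f
    using S(1) by (auto simp: leaf_children_def)
  moreover have "S' \<subseteq> leaf_children V f w \<longleftrightarrow> (\<forall>s\<in>S'. f s = ?c s \<and> s \<notin> f ` V)" for f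
  proof -
    have "?c s = w" if "s \<in> S'" for s using that disj by auto
    then show ?thesis using S(2) by (auto simp: leaf_children_def)
  qed
  ultimately have "?A = {f \<in> parent_trees V. \<forall>s\<in>S \<union> S'. f s = ?c s \<and> s \<notin> f ` V}"
    by (simp only: ball_Un)
  also have "card \<dots> = card (parent_trees (V - (S \<union> S')))"
    by (rule card_parent_trees_leaves) (use S v notin in auto)
  also have "\<dots> = (card V - 2 * k) ^ (card V - 2 * k - 1)"
  proof -
    have "finite S" "finite S'" using S V finite_subset by auto
    then have "card (V - (S \<union> S')) = card V - 2 * k"
      using S disj by (subst card_Diff_subset) (auto simp: card_Un_disjoint)
    moreover have "V - (S \<union> S') \<noteq> {}" using v notin by auto
    ultimately show ?thesis using card_parent_trees V by (metis finite_Diff)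
  qed
  finally show ?thesis by simp
qed (metis card.empty zero_le)

lemma card_same_leaf_stars_le:
  assumes V: "finite V" and v: "v \<in> V" and S: "S \<subseteq> V - {v}" "S' \<subseteq> V - {v}"
  shows "real (card {f \<in> parent_trees V. S \<subseteq> leaf_children V f v \<and> S' \<subseteq> leaf_children V f v}) \<le>
    real (card V) ^ (card V - card S - 1) * (1 / real (card V)) ^ card (S' - S)" (is "real (card ?A) \<le> _")
proof -
  have fin: "finite S" "finite S'" using S V finite_subset by blast+
  have n: "card V > 0" using V v card_gt_0_iff by blast
  have "card ?A \<le> card {f \<in> parent_trees V. \<forall>s\<in>S \<union> S'. f s = v}"
    using finite_parent_trees[OF V] by (intro card_mono) (auto simp: leaf_children_def)
  also have "\<dots> = card V ^ (card V - card (S \<union> S') - 1)"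
    by (rule card_parent_trees_star) (use V v S in auto)
  finally have le: "real (card ?A) \<le> real (card V) ^ (card V - card (S \<union> S') - 1)"
    by (simp only: of_nat_le_iff flip: of_nat_power)
  have un: "card (S \<union> S') = card S + card (S' - S)"
    using card_Un_disjoint[of S "S' - S"] fin by (simp add: Un_Diff_cancel)
  have "S \<union> S' \<subset> V" using S v by auto
  then have less: "card (S \<union> S') < card V" by (rule psubset_card_mono[OF V])
  have "real (card V) ^ (card V - card S - 1) =
      real (card V) ^ (card V - card (S \<union> S') - 1) * real (card V) ^ card (S' - S)"
    using un less by (simp flip: power_add)
  then have "real (card V) ^ (card V - card S - 1) * (1 / real (card V)) ^ card (S' - S) =
      real (card V) ^ (card V - card (S \<union> S') - 1)"
    using n by (simp add: power_divide)
  then show ?thesis using le by simp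
qed

text \<open>
  Chebyshev's inequality for the number of pairs of a vertex \<open>v\<close> and a set of \<open>k\<close> leaves hanging from
  \<open>v\<close>: there are \<open>p\<close> candidate pairs, and \<open>a j\<close> rooted trees remain after deleting \<open>j\<close> leaves.
\<close>

lemma card_no_leaf_bundle_le:
  fixes V :: "'a set" and k :: nat
  assumes V: "finite V" and k: "k > 0" "k < card V"
  defines "n \<equiv> real (card V)"
    and "a \<equiv> \<lambda>j. real ((card V - j) ^ (card V - j - 1))"
    and "p \<equiv> real (card V * (card V - 1 choose k))"
  shows "real (card {f \<in> parent_trees V. \<forall>v\<in>V. card (leaf_children V f v) < k}) * (p * a k)\<^sup>2 \<le>
    a 0 * (a 0 * (p\<^sup>2 * a (2 * k) + p * (n ^ (card V - k - 1) * (3 * 2 ^ k))) - (p * a k)\<^sup>2)"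
proof -
  let ?T = "parent_trees V"
  define P where "P = (SIGMA v:V. {S. S \<subseteq> V - {v} \<and> card S = k})"
  define I where "I = (\<lambda>f (v, S). of_bool (S \<subseteq> leaf_children V f v) :: real)"
  define X where "X = (\<lambda>f. \<Sum>q\<in>P. I f q)"
  have finT: "finite ?T" using finite_parent_trees[OF V] .
  have finS: "finite {S. S \<subseteq> V - {v} \<and> card S = k}" for v
    using V by (auto intro: finite_subset[of _ "Pow V"])
  have finP: "finite P" using V finS by (auto simp: P_def)
  have cardV: "card V > 0" using k by simp
  have cardT: "real (card ?T) = a 0"
    using card_parent_trees[OF V] cardV unfolding a_def card_gt_0_iff by simp
  have cardP: "real (card P) = p"
    using V n_subsets[of "V - {v}" k for v] by (simp add: P_def p_def card_SigmaI finS)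
  have meas: "(\<Sum>f\<in>?T. of_bool (Q f)) = real (card {f \<in> ?T. Q f})" for Q
    using finT by (simp add: Int_def conj_commute)
  have one: "(\<Sum>f\<in>?T. I f q) = a k" if qP: "q \<in> P" for q
  proof -
    obtain v S where q: "q = (v, S)" "v \<in> V" "S \<subseteq> V - {v}" "card S = k"
      using qP by (auto simp: P_def)
    have "(\<Sum>f\<in>?T. I f q) = real (card {f \<in> ?T. S \<subseteq> leaf_children V f v})"
      by (simp only: I_def q prod.case meas)
    also have "{f \<in> ?T. S \<subseteq> leaf_children V f v} = {f \<in> ?T. \<forall>s\<in>S. f s = v \<and> s \<notin> f ` V}"
      using q by (auto simp: leaf_children_def)
    also have "card \<dots> = card (parent_trees (V - S))"
      using q by (intro card_parent_trees_leaves) auto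
    also have "\<dots> = (card V - k) ^ (card V - k - 1)"
    proof -
      have "finite S" using q(3) V by (meson Diff_subset finite_subset)
      moreover have "V - S \<noteq> {}" "S \<subseteq> V" using q(2,3) by auto
      ultimately have "card (V - S) = card V - k" using q(4) by (simp add: card_Diff_subset)
      then show ?thesis using card_parent_trees[of "V - S"] V \<open>V - S \<noteq> {}\<close> by simp
    qed
    finally show ?thesis by (simp add: a_def)
  qed
  have sumX: "(\<Sum>f\<in>?T. X f) = p * a k"
  proof -
    have "(\<Sum>f\<in>?T. X f) = (\<Sum>q\<in>P. \<Sum>f\<in>?T. I f q)" unfolding X_def by (rule sum.swap)
    also have "\<dots> = (\<Sum>q\<in>P. a k)" by (intro sum.cong refl one)
    finally show ?thesis using cardP by simp
  qed
  define B where "B = (\<lambda>q q'. \<Sum>f\<in>?T. I f q * I f q')"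
  have B_eq: "B (v, S) (w, S') =
      real (card {f \<in> ?T. S \<subseteq> leaf_children V f v \<and> S' \<subseteq> leaf_children V f w})" for v S w S'
    unfolding B_def I_def prod.case of_bool_conj[symmetric] by (rule meas)
  have sumX2: "(\<Sum>f\<in>?T. (X f)\<^sup>2) \<le> p\<^sup>2 * a (2 * k) + p * (n ^ (card V - k - 1) * (3 * 2 ^ k))"
  proof -
    have "(\<Sum>f\<in>?T. (X f)\<^sup>2) = (\<Sum>f\<in>?T. \<Sum>q\<in>P. \<Sum>q'\<in>P. I f q * I f q')"
      by (simp add: X_def power2_eq_square sum_product)
    also have "\<dots> = (\<Sum>q\<in>P. \<Sum>q'\<in>P. B q q')"
      unfolding B_def by (subst sum.swap, intro sum.cong refl sum.swap)
    also have "\<dots> \<le> (\<Sum>q\<in>P. p * a (2 * k) + n ^ (card V - k - 1) * (3 * 2 ^ k))"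
    proof (rule sum_mono)
      fix q assume "q \<in> P"
      then obtain v S where q: "q = (v, S)" "v \<in> V" "S \<subseteq> V - {v}" "card S = k"
        by (auto simp: P_def)
      let ?same = "Pair v ` {S'. S' \<subseteq> V - {v} \<and> card S' = k}"
      have same: "?same \<subseteq> P" using q by (auto simp: P_def)
      have "(\<Sum>q'\<in>P. B q q') = (\<Sum>q'\<in>P - ?same. B q q') + (\<Sum>q'\<in>?same. B q q')"
        by (rule sum.subset_diff[OF same finP])
      moreover have "(\<Sum>q'\<in>P - ?same. B q q') \<le> (\<Sum>q'\<in>P - ?same. a (2 * k))"
      proof (rule sum_mono)
        fix q' assume "q' \<in> P - ?same"
        then obtain w S' where q': "q' = (w, S')" "w \<in> V" "S' \<subseteq> V - {w}" "card S' = k" "w \<noteq> v"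
          by (auto simp: P_def)
        have "card {f \<in> ?T. S \<subseteq> leaf_children V f v \<and> S' \<subseteq> leaf_children V f w} \<le>
          (card V - 2 * k) ^ (card V - 2 * k - 1)"
          by (rule card_two_leaf_stars_le[OF V]) (use q q' k in auto)
        then show "B q q' \<le> a (2 * k)"
          unfolding q q' B_eq a_def of_nat_le_iff .
      qed
      moreover have "(\<Sum>q'\<in>P - ?same. a (2 * k)) \<le> p * a (2 * k)"
        using finP cardP card_mono[OF finP, of "P - ?same"] by (simp add: a_def mult_right_mono Diff_subset)
      moreover have "(\<Sum>q'\<in>?same. B q q') \<le> n ^ (card V - k - 1) * (3 * 2 ^ k)"
      proof -
        have "(\<Sum>q'\<in>?same. B q q') = (\<Sum>S' | S' \<subseteq> V - {v} \<and> card S' = k. B (v, S) (v, S'))"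
          unfolding q(1) by (subst sum.reindex) (simp_all add: inj_on_def)
        also have "\<dots> \<le> (\<Sum>S' | S' \<subseteq> V - {v} \<and> card S' = k. n ^ (card V - k - 1) * (1 / n) ^ card (S' - S))"
          unfolding B_eq n_def using card_same_leaf_stars_le[OF V q(2,3), unfolded q(4)] by (intro sum_mono) blast
        also have "\<dots> \<le> (\<Sum>S'\<in>Pow V. n ^ (card V - k - 1) * (1 / n) ^ card (S' - S))"
          using V by (intro sum_mono2) (auto simp: n_def)
        also have "\<dots> = n ^ (card V - k - 1) * (2 ^ k * (1 + 1 / n) ^ (card V - k))"
          using sum_subsets_power_diff[OF V, of S "1 / n"] q(3,4) by (auto simp flip: sum_distrib_left)
        also have "\<dots> \<le> n ^ (card V - k - 1) * (3 * 2 ^ k)"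
        proof -
          have "(1 + 1 / n) ^ (card V - k) \<le> (1 + 1 / n) ^ card V"
            by (intro power_increasing) (auto simp: n_def)
          also have "\<dots> \<le> exp (1 / n) ^ card V"
            by (intro power_mono) (auto simp: n_def)
          also have "\<dots> = exp 1" using cardV by (simp add: n_def flip: exp_of_nat_mult)
          also have "\<dots> \<le> 3" by (rule exp_le)
          finally show ?thesis by (simp add: n_def mult_left_mono)
        qed
        finally show ?thesis .
      qed
      ultimately show "(\<Sum>q'\<in>P. B q q') \<le> p * a (2 * k) + n ^ (card V - k - 1) * (3 * 2 ^ k)" by linarith
    qed
    also have "\<dots> = p\<^sup>2 * a (2 * k) + p * (n ^ (card V - k - 1) * (3 * 2 ^ k))"
      by (simp add: cardP algebra_simps power2_eq_square)
    finally show ?thesis .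
  qed
  have "X f = 0" if "\<forall>v\<in>V. card (leaf_children V f v) < k" for f
  proof -
    have "\<not> S \<subseteq> leaf_children V f v" if "v \<in> V" "card S = k" for v S
    proof
      assume "S \<subseteq> leaf_children V f v"
      then have "card S \<le> card (leaf_children V f v)"
        using V by (intro card_mono) (auto simp: leaf_children_def)
      then show False using that \<open>\<forall>v\<in>V. card (leaf_children V f v) < k\<close> by auto
    qed
    then show ?thesis by (auto simp: X_def I_def P_def intro!: sum.neutral)
  qed
  then have "card {f \<in> ?T. \<forall>v\<in>V. card (leaf_children V f v) < k} \<le> card {f \<in> ?T. X f = 0}"
    using finT by (intro card_mono) auto
  then have "real (card {f \<in> ?T. \<forall>v\<in>V. card (leaf_children V f v) < k}) * (p * a k)\<^sup>2 \<le>
      real (card {f \<in> ?T. X f = 0}) * (p * a k)\<^sup>2"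
    by (intro mult_right_mono) auto
  also have "\<dots> \<le> a 0 * (a 0 * (\<Sum>f\<in>?T. (X f)\<^sup>2) - (p * a k)\<^sup>2)"
    using second_moment_count[OF finT, of X] by (simp add: sumX cardT)
  also have "\<dots> \<le> a 0 * (a 0 * (p\<^sup>2 * a (2 * k) + p * (n ^ (card V - k - 1) * (3 * 2 ^ k))) - (p * a k)\<^sup>2)"
    using sumX2 by (intro mult_left_mono diff_right_mono) (auto simp: a_def)
  finally show ?thesis .
qed

lemma card_many_children_le:
  assumes V: "finite V" and k: "k < card V"
  shows "real (card {f \<in> parent_trees V. \<exists>v\<in>V. k \<le> card {s \<in> V - {v}. f s = v}}) \<le>
    real (card (parent_trees V)) * (real (card V) / fact k)"
proof -
  let ?n = "card V"
  have n: "?n > 0" using k by simp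
  define P where "P = (SIGMA v:V. {S. S \<subseteq> V - {v} \<and> card S = k})"
  have finS: "finite {S. S \<subseteq> V - {v} \<and> card S = k}" for v
    using V by (auto intro: finite_subset[of _ "Pow V"])
  have finP: "finite P" using V finS by (auto simp: P_def)
  have cardP: "card P = ?n * (?n - 1 choose k)"
    using V n_subsets[of "V - {v}" k for v] by (simp add: P_def card_SigmaI finS)
  let ?F = "\<lambda>(v, S). {f \<in> parent_trees V. \<forall>s\<in>S. f s = v}"
  have "{f \<in> parent_trees V. \<exists>v\<in>V. k \<le> card {s \<in> V - {v}. f s = v}} \<subseteq> (\<Union>q\<in>P. ?F q)"
  proof
    fix f assume "f \<in> {f \<in> parent_trees V. \<exists>v\<in>V. k \<le> card {s \<in> V - {v}. f s = v}}"
    then obtain v where f: "f \<in> parent_trees V" "v \<in> V" "k \<le> card {s \<in> V - {v}. f s = v}" by auto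
    obtain S where "S \<subseteq> {s \<in> V - {v}. f s = v}" "card S = k"
      using obtain_subset_with_card_n[OF f(3)] by metis
    then show "f \<in> (\<Union>q\<in>P. ?F q)" using f by (auto simp: P_def intro!: bexI[of _ "(v, S)"])
  qed
  then have "card {f \<in> parent_trees V. \<exists>v\<in>V. k \<le> card {s \<in> V - {v}. f s = v}} \<le> card (\<Union>q\<in>P. ?F q)"
    using finP finite_parent_trees[OF V] by (intro card_mono) auto
  also have "\<dots> \<le> (\<Sum>q\<in>P. card (?F q))" by (rule card_UN_le[OF finP])
  also have "\<dots> = (\<Sum>q\<in>P. ?n ^ (?n - k - 1))"
    by (intro sum.cong refl) (use card_parent_trees_star[OF V] in \<open>auto simp: P_def\<close>)
  also have "\<dots> = ?n * (?n - 1 choose k) * ?n ^ (?n - k - 1)" by (simp add: cardP)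
  finally have "real (card {f \<in> parent_trees V. \<exists>v\<in>V. k \<le> card {s \<in> V - {v}. f s = v}}) \<le>
      real ?n * real (?n - 1 choose k) * real ?n ^ (?n - k - 1)"
    by (simp only: of_nat_le_iff flip: of_nat_power of_nat_mult)
  also have "\<dots> \<le> real ?n * (real ?n ^ k / fact k) * real ?n ^ (?n - k - 1)"
  proof -
    have "(?n - 1 choose k) * fact k \<le> (?n - 1) ^ k" by (rule binomial_fact_pow)
    also have "\<dots> \<le> ?n ^ k" by (intro power_mono) auto
    finally have "real ((?n - 1 choose k) * fact k) \<le> real (?n ^ k)"
      by (simp only: of_nat_le_iff)
    then have "real (?n - 1 choose k) * fact k \<le> real ?n ^ k" by simp
    then have "real (?n - 1 choose k) \<le> real ?n ^ k / fact k" by (simp add: pos_le_divide_eq)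
    then show ?thesis by (intro mult_right_mono mult_left_mono) simp_all
  qed
  also have "\<dots> = real ?n ^ (k + (?n - k - 1)) * (real ?n / fact k)" by (simp add: power_add)
  also have "k + (?n - k - 1) = ?n - 1" using k by simp
  finally show ?thesis using card_parent_trees[OF V] n by (auto simp: card_gt_0_iff)
qed

section \<open>Logical depth of a graph with many leaves at one vertex\<close>

definition leaf_bundle :: "'a set \<Rightarrow> ('a \<times> 'a) set \<Rightarrow> 'a \<Rightarrow> 'a set \<Rightarrow> 'a pair_pre_digraph \<Rightarrow> bool" where
  "leaf_bundle C E v L G \<longleftrightarrow> pverts G = C \<union> L \<and> parcs G = E \<union> L \<times> {v} \<union> {v} \<times> L \<and>
     C \<inter> L = {} \<and> E \<subseteq> C \<times> C \<and> v \<in> C"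

definition leaf_equiv ::
  "'a set \<Rightarrow> 'a set \<Rightarrow> 'a set \<Rightarrow> nat set \<Rightarrow> (nat \<Rightarrow> 'a) \<Rightarrow> (nat \<Rightarrow> 'a) \<Rightarrow> bool" where
  "leaf_equiv C L L' W e e' \<longleftrightarrow>
     (\<forall>x\<in>W. e x \<in> C \<and> e' x = e x \<or> e x \<in> L \<and> e' x \<in> L') \<and>
     (\<forall>x\<in>W. \<forall>y\<in>W. e x = e y \<longleftrightarrow> e' x = e' y)"

lemma leaf_equiv_mono: "leaf_equiv C L L' W e e' \<Longrightarrow> W' \<subseteq> W \<Longrightarrow> leaf_equiv C L L' W' e e'"
  unfolding leaf_equiv_def by blast

lemma leaf_equiv_sym: "leaf_equiv C L L' W e e' \<Longrightarrow> leaf_equiv C L' L W e' e"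
  unfolding leaf_equiv_def by metis

lemma leaf_equiv_extend:
  assumes eq: "leaf_equiv C L L' W e e'" and disj: "C \<inter> L = {}" "C \<inter> L' = {}"
    and W: "finite W" "card W < card L'" "x \<notin> W" and w: "w \<in> C \<union> L"
  obtains w' where "w' \<in> C \<union> L'" "leaf_equiv C L L' (insert x W) (e(x := w)) (e'(x := w'))"
proof -
  have fresh: "leaf_equiv C L L' (insert x W) (e(x := w)) (e'(x := w'))"
    if "w \<in> C \<and> w' = w \<or> w \<in> L \<and> w' \<in> L'" "\<And>y. y \<in> W \<Longrightarrow> w = e y \<longleftrightarrow> w' = e' y" for w'
  proof -
    have old: "(e(x := w)) y = e y" "(e'(x := w')) y = e' y" if "y \<in> W" for y
      using that W(3) by auto
    have new: "(e(x := w)) x = w" "(e'(x := w')) x = w'" by auto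
    have "e y \<in> C \<and> e' y = e y \<or> e y \<in> L \<and> e' y \<in> L'" if "y \<in> W" for y
      using eq that by (simp add: leaf_equiv_def)
    moreover have "e y = e z \<longleftrightarrow> e' y = e' z" if "y \<in> W" "z \<in> W" for y z
      using eq that by (simp add: leaf_equiv_def)
    moreover have "e y = w \<longleftrightarrow> e' y = w'" if "y \<in> W" for y
      using that \<open>\<And>y. y \<in> W \<Longrightarrow> w = e y \<longleftrightarrow> w' = e' y\<close> by auto
    moreover note \<open>w \<in> C \<and> w' = w \<or> w \<in> L \<and> w' \<in> L'\<close>
    ultimately show ?thesis
      unfolding leaf_equiv_def ball_simps(7) by (simp del: fun_upd_apply add: old new eq_commute)
  qed
  consider "w \<in> C" | y where "w \<in> L" "y \<in> W" "e y = w" | "w \<in> L" "w \<notin> e ` W"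
    using w by auto
  then show ?thesis
  proof cases
    case 1
    have "w = e y \<longleftrightarrow> w = e' y" if "y \<in> W" for y
    proof -
      have "e y \<in> C \<and> e' y = e y \<or> e y \<in> L \<and> e' y \<in> L'" using eq that by (simp add: leaf_equiv_def)
      then show ?thesis using 1 disj by auto
    qed
    then show ?thesis using 1 by (intro that[of w] fresh) auto
  next
    case (2 y)
    then have "e' y \<in> L'" using eq disj by (auto simp: leaf_equiv_def)
    then show ?thesis using 2 eq
      by (intro that[of "e' y"] fresh) (auto simp: leaf_equiv_def)
  next
    case 3
    have "card (e' ` W) < card L'" using card_image_le[OF W(1), of e'] W(2) by linarith
    then have "\<not> L' \<subseteq> e' ` W" using W(1) card_mono[of "e' ` W" L'] by auto
    then obtain w' where "w' \<in> L'" "w' \<notin> e' ` W" by auto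
    then show ?thesis using 3
      by (intro that[of w'] fresh) auto
  qed
qed

lemma sat_quantifier_leaf_equiv:
  assumes G: "leaf_bundle C E v L G" and H: "leaf_bundle C E v L' H"
    and eq: "leaf_equiv C L L' W e e'" and W: "finite W" "free_vars \<phi> - {x} \<subseteq> W"
    and card: "card W < card L" "card W < card L'"
    and step: "\<And>W' e e'. leaf_equiv C L L' W' e e' \<Longrightarrow> finite W' \<Longrightarrow> free_vars \<phi> \<subseteq> W' \<Longrightarrow>
      card W' \<le> Suc (card W) \<Longrightarrow> sat G e \<phi> \<longleftrightarrow> sat H e' \<phi>"
  shows "sat G e (Exi x \<phi>) \<longleftrightarrow> sat H e' (Exi x \<phi>)" and "sat G e (All x \<phi>) \<longleftrightarrow> sat H e' (All x \<phi>)"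
proof -
  let ?W = "free_vars \<phi> - {x}"
  have fin: "finite ?W" and le: "card ?W \<le> card W"
    using finite_subset[OF W(2,1)] card_mono[OF W] by auto
  have eq': "leaf_equiv C L L' ?W e e'" using eq W(2) by (rule leaf_equiv_mono)
  have card': "card (insert x ?W) = Suc (card ?W)" using fin by (subst card_insert_disjoint) auto
  have disj: "C \<inter> L = {}" "C \<inter> L' = {}" using G H by (auto simp: leaf_bundle_def)
  have step': "sat G (e(x := w)) \<phi> = sat H (e'(x := w')) \<phi>"
    if "leaf_equiv C L L' (insert x ?W) (e(x := w)) (e'(x := w'))" for w w'
    using that by (rule step) (use fin card' le in auto)
  have forw: "\<exists>w'\<in>pverts H. sat G (e(x := w)) \<phi> = sat H (e'(x := w')) \<phi>" if "w \<in> pverts G" for w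
  proof -
    have w: "w \<in> C \<union> L" using that G by (simp add: leaf_bundle_def)
    have less: "card ?W < card L'" using le card by linarith
    obtain w' where "w' \<in> C \<union> L'" "leaf_equiv C L L' (insert x ?W) (e(x := w)) (e'(x := w'))"
      by (rule leaf_equiv_extend[where x = x, OF eq' disj fin less _ w]) simp_all
    then show ?thesis using step' H by (auto simp: leaf_bundle_def)
  qed
  have backw: "\<exists>w\<in>pverts G. sat G (e(x := w)) \<phi> = sat H (e'(x := w')) \<phi>" if "w' \<in> pverts H" for w'
  proof -
    have w': "w' \<in> C \<union> L'" using that H by (simp add: leaf_bundle_def)
    have less: "card ?W < card L" using le card by linarith
    obtain w where "w \<in> C \<union> L" "leaf_equiv C L' L (insert x ?W) (e'(x := w')) (e(x := w))"
      by (rule leaf_equiv_extend[where x = x, OF leaf_equiv_sym[OF eq'] disj(2,1) fin less _ w']) simp_all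
    then show ?thesis using step'[OF leaf_equiv_sym] G by (auto simp: leaf_bundle_def)
  qed
  show "sat G e (Exi x \<phi>) \<longleftrightarrow> sat H e' (Exi x \<phi>)" "sat G e (All x \<phi>) \<longleftrightarrow> sat H e' (All x \<phi>)"
    using forw backw by simp_all blast+
qed

lemma sat_leaf_equiv:
  assumes G: "leaf_bundle C E v L G" and H: "leaf_bundle C E v L' H"
  shows "leaf_equiv C L L' W e e' \<Longrightarrow> finite W \<Longrightarrow> free_vars \<phi> \<subseteq> W \<Longrightarrow>
    card W + quantifier_depth \<phi> \<le> card L \<Longrightarrow> card W + quantifier_depth \<phi> \<le> card L' \<Longrightarrow>
    sat G e \<phi> \<longleftrightarrow> sat H e' \<phi>"
proof (induction \<phi> arbitrary: W e e')
  case (Adj x y)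
  have "e z \<in> C \<and> e' z = e z \<or> e z \<in> L \<and> e' z \<in> L'" if "z \<in> {x, y}" for z
    using that Adj.prems(1,3) by (auto simp: leaf_equiv_def)
  from this[of x] this[of y] show ?case
    using G H by (auto simp: leaf_bundle_def)
next
  case (Exi x \<phi>)
  show ?case
  proof (rule sat_quantifier_leaf_equiv(1)[OF G H Exi.prems(1,2)])
    show "sat G e \<phi> \<longleftrightarrow> sat H e' \<phi>" if "leaf_equiv C L L' W' e e'" "finite W'"
      "free_vars \<phi> \<subseteq> W'" "card W' \<le> Suc (card W)" for W' e e'
      using that(1-3) by (rule Exi.IH) (use that(4) Exi.prems in auto)
  qed (use Exi.prems in auto)
next
  case (All x \<phi>)
  show ?case
  proof (rule sat_quantifier_leaf_equiv(2)[OF G H All.prems(1,2)])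
    show "sat G e \<phi> \<longleftrightarrow> sat H e' \<phi>" if "leaf_equiv C L L' W' e e'" "finite W'"
      "free_vars \<phi> \<subseteq> W'" "card W' \<le> Suc (card W)" for W' e e'
      using that(1-3) by (rule All.IH) (use that(4) All.prems in auto)
  qed (use All.prems in auto)
next
  case (Neg \<phi>)
  show ?case using Neg.IH[OF Neg.prems(1,2)] Neg.prems(3-5) by simp
next
  case (Conj \<phi> \<psi>)
  show ?case using Conj.IH[OF Conj.prems(1,2)] Conj.prems(3-5) by simp
next
  case (Disj \<phi> \<psi>)
  show ?case using Disj.IH[OF Disj.prems(1,2)] Disj.prems(3-5) by simp
next
  case (Impl \<phi> \<psi>)
  show ?case using Impl.IH[OF Impl.prems(1,2)] Impl.prems(3-5) by simp
qed (auto simp: leaf_equiv_def)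

lemma digraph_iso_card:
  assumes "digraph_iso G H"
  shows "card (verts G) = card (verts H)"
  using assms
  by (auto simp: digraph_iso_def pre_digraph.digraph_isomorphism_def card_image)

lemma leaf_bundle_quantifier_depth:
  fixes G :: "nat pair_pre_digraph"
  assumes G: "pair_graph G" "leaf_bundle C E v L G" and "defines_graph \<phi> G"
  shows "card L < quantifier_depth \<phi>"
proof (rule ccontr)
  assume "\<not> card L < quantifier_depth \<phi>"
  then have qd: "quantifier_depth \<phi> \<le> card L" by simp
  interpret pair_graph G by fact
  have finV: "finite (pverts G)" by (rule pair_finite_verts)
  obtain z where z: "z \<notin> pverts G" using finV ex_new_if_finite infinite_UNIV_nat by metis
  define H where "H = \<lparr>pverts = insert z (pverts G), parcs = parcs G \<union> {(z, v), (v, z)}\<rparr>"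
  have v: "v \<in> pverts G" using G(2) by (auto simp: leaf_bundle_def)
  have H_leaves: "leaf_bundle C E v (insert z L) H"
    using G(2) z by (auto simp: leaf_bundle_def H_def)
  have finL: "finite L" using G(2) finV by (auto simp: leaf_bundle_def)
  have "pair_graph H"
  proof
    show "finite (parcs H)" using pair_finite_arcs by (simp add: H_def)
    show "finite (pverts H)" using finV by (simp add: H_def)
    show "symmetric (with_proj H)"
      using arcs_symmetric by (auto simp: symmetric_def H_def intro!: symI)
  qed (use v z no_loops' in \<open>auto simp: H_def dest: wellformed'\<close>)
  moreover have "\<not> digraph_iso (with_proj G) (with_proj H)"
    using digraph_iso_card[of "with_proj G" "with_proj H"] finV z by (auto simp: H_def)
  ultimately have "\<not> true_in H \<phi>" "true_in G \<phi>" "sentence \<phi>"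
    using assms(3) by (auto simp: defines_graph_def)
  moreover have "sat G e \<phi> \<longleftrightarrow> sat H e \<phi>" for e
    by (rule sat_leaf_equiv[OF G(2) H_leaves, of "{}"])
      (use qd finL \<open>sentence \<phi>\<close> in \<open>auto simp: leaf_equiv_def sentence_def card_insert_if\<close>)
  ultimately show False by (simp add: true_in_def)
qed

lemma leaf_bundleI:
  assumes "pair_graph G" "v \<in> pverts G" "v \<notin> L" "L \<subseteq> pverts G"
    and "\<And>s y. s \<in> L \<Longrightarrow> (s, y) \<in> parcs G \<longleftrightarrow> y = v"
  shows "leaf_bundle (pverts G - L) (parcs G \<inter> (pverts G - L) \<times> (pverts G - L)) v L G"
proof -
  interpret pair_graph G by fact
  have "(y, s) \<in> parcs G \<longleftrightarrow> y = v" if "s \<in> L" for s y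
    using assms(5)[OF that] arcs_symmetric by blast
  then show ?thesis
    using assms(2-5) wellformed' unfolding leaf_bundle_def by auto
qed

fun exists_upto :: "nat \<Rightarrow> fo \<Rightarrow> fo" where
  "exists_upto 0 \<phi> = \<phi>"
| "exists_upto (Suc n) \<phi> = exists_upto n (Exi n \<phi>)"

definition truth :: fo where
  "truth = All 0 (Eq 0 0)"

definition big_conj :: "fo list \<Rightarrow> fo" where
  "big_conj xs = foldr Conj xs truth"

definition big_disj :: "fo list \<Rightarrow> fo" where
  "big_disj xs = foldr Disj xs (Neg truth)"

definition literal :: "bool \<Rightarrow> fo \<Rightarrow> fo" where
  "literal b \<phi> = (if b then \<phi> else Neg \<phi>)"

lemma free_vars_exists_upto: "free_vars (exists_upto n \<phi>) = free_vars \<phi> - {..<n}"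
  by (induction n arbitrary: \<phi>) auto

lemma sat_exists_upto:
  "sat G e (exists_upto n \<phi>) \<longleftrightarrow>
    (\<exists>h. (\<forall>i<n. h i \<in> pverts G) \<and> sat G (\<lambda>i. if i < n then h i else e i) \<phi>)"
proof (induction n arbitrary: \<phi>)
  case (Suc n)
  have upd: "(\<lambda>i. if i < n then h i else e i)(n := w) =
      (\<lambda>i. if i < Suc n then (h(n := w)) i else e i)" for h :: "nat \<Rightarrow> 'a" and w
    by (auto simp: fun_eq_iff)
  have "sat G e (exists_upto (Suc n) \<phi>) \<longleftrightarrow>
      (\<exists>h w. (\<forall>i<n. h i \<in> pverts G) \<and> w \<in> pverts G \<and>
        sat G (\<lambda>i. if i < Suc n then (h(n := w)) i else e i) \<phi>)"
    using Suc by (auto simp: upd)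
  also have "\<dots> \<longleftrightarrow> (\<exists>h. (\<forall>i<Suc n. h i \<in> pverts G) \<and> sat G (\<lambda>i. if i < Suc n then h i else e i) \<phi>)"
  proof
    assume "\<exists>h w. (\<forall>i<n. h i \<in> pverts G) \<and> w \<in> pverts G \<and>
        sat G (\<lambda>i. if i < Suc n then (h(n := w)) i else e i) \<phi>"
    then obtain h w where "\<forall>i<n. h i \<in> pverts G" "w \<in> pverts G"
        "sat G (\<lambda>i. if i < Suc n then (h(n := w)) i else e i) \<phi>" by blast
    then show "\<exists>h. (\<forall>i<Suc n. h i \<in> pverts G) \<and> sat G (\<lambda>i. if i < Suc n then h i else e i) \<phi>"
      by (intro exI[of _ "h(n := w)"]) (auto simp: less_Suc_eq)
  next
    assume "\<exists>h. (\<forall>i<Suc n. h i \<in> pverts G) \<and> sat G (\<lambda>i. if i < Suc n then h i else e i) \<phi>"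
    then obtain h where "\<forall>i<Suc n. h i \<in> pverts G" "sat G (\<lambda>i. if i < Suc n then h i else e i) \<phi>"
      by blast
    then show "\<exists>h w. (\<forall>i<n. h i \<in> pverts G) \<and> w \<in> pverts G \<and>
        sat G (\<lambda>i. if i < Suc n then (h(n := w)) i else e i) \<phi>"
      by (intro exI[of _ h] exI[of _ "h n"]) (simp only: fun_upd_triv, simp)
  qed
  finally show ?case .
qed simp

lemma sat_big_conj: "sat G e (big_conj xs) \<longleftrightarrow> (\<forall>\<phi>\<in>set xs. sat G e \<phi>)"
  unfolding big_conj_def by (induction xs) (auto simp: truth_def)

lemma sat_big_disj: "sat G e (big_disj xs) \<longleftrightarrow> (\<exists>\<phi>\<in>set xs. sat G e \<phi>)"
  unfolding big_disj_def by (induction xs) (auto simp: truth_def)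

lemma free_vars_big_conj: "free_vars (big_conj xs) = \<Union> (free_vars ` set xs)"
  unfolding big_conj_def by (induction xs) (auto simp: truth_def)

lemma free_vars_big_disj: "free_vars (big_disj xs) = \<Union> (free_vars ` set xs)"
  unfolding big_disj_def by (induction xs) (auto simp: truth_def)

lemma sat_literal [simp]: "sat G e (literal b \<phi>) \<longleftrightarrow> (sat G e \<phi> \<longleftrightarrow> b)"
  by (simp add: literal_def)

lemma free_vars_literal [simp]: "free_vars (literal b \<phi>) = free_vars \<phi>"
  by (simp add: literal_def)

definition diagram :: "'a pair_pre_digraph \<Rightarrow> nat \<Rightarrow> (nat \<Rightarrow> 'a) \<Rightarrow> fo" where
  "diagram G n g = Conj
     (big_conj (map (\<lambda>(i, j). Conj (literal (g i = g j) (Eq i j)) (literal ((g i, g j) \<in> parcs G) (Adj i j)))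
        (List.product [0..<n] [0..<n])))
     (All n (big_disj (map (\<lambda>i. Eq n i) [0..<n])))"

lemma sat_diagram:
  "sat H h (diagram G n g) \<longleftrightarrow>
    (\<forall>i<n. \<forall>j<n. (h i = h j \<longleftrightarrow> g i = g j) \<and> ((h i, h j) \<in> parcs H \<longleftrightarrow> (g i, g j) \<in> parcs G)) \<and>
    (\<forall>y\<in>pverts H. \<exists>i<n. y = h i)"
  by (auto simp: diagram_def sat_big_conj sat_big_disj atLeast0LessThan Ball_def Bex_def)

lemma free_vars_diagram: "free_vars (diagram G n g) \<subseteq> {..<n}"
  by (auto simp: diagram_def free_vars_big_conj free_vars_big_disj)

lemma digraph_isoI_pair:
  assumes "pair_wf_digraph G" "pair_wf_digraph H" "bij_betw f (pverts G) (pverts H)"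
    and adj: "\<And>u v. u \<in> pverts G \<Longrightarrow> v \<in> pverts G \<Longrightarrow> (u, v) \<in> parcs G \<longleftrightarrow> (f u, f v) \<in> parcs H"
  shows "digraph_iso (with_proj G) (with_proj H)"
proof -
  interpret G: pair_wf_digraph G by fact
  interpret H: pair_wf_digraph H by fact
  define hom where "hom = \<lparr>iso_verts = f, iso_arcs = map_prod f f, iso_head = snd, iso_tail = fst\<rparr>"
  have inj: "inj_on f (pverts G)" and img: "f ` pverts G = pverts H"
    using assms(3) by (auto simp: bij_betw_def)
  have "inj_on (map_prod f f) (parcs G)"
    using inj by (clarsimp simp: inj_on_def) (metis G.in_arcsD1 G.in_arcsD2)
  then have "pre_digraph.digraph_isomorphism (with_proj G) hom"
    using inj by (auto simp: pre_digraph.digraph_isomorphism_def hom_def G.wf_digraph_axioms)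
  moreover have "map_prod f f ` parcs G = parcs H"
  proof (intro equalityI subrelI)
    fix a b assume "(a, b) \<in> map_prod f f ` parcs G"
    then show "(a, b) \<in> parcs H" using adj by (auto dest: G.wellformed')
  next
    fix a b assume ab: "(a, b) \<in> parcs H"
    then obtain u v where "u \<in> pverts G" "v \<in> pverts G" "a = f u" "b = f v"
      using img H.wellformed'[OF ab] by blast
    then show "(a, b) \<in> map_prod f f ` parcs G" using adj ab by force
  qed
  then have "with_proj H = app_iso hom (with_proj G)"
    using img by (simp add: app_iso_def hom_def with_proj_def)
  ultimately show ?thesis by (auto simp: digraph_iso_def)
qed

lemma ex_defines_graph:
  assumes "pair_graph G"
  shows "\<exists>\<phi>. defines_graph \<phi> G"
proof -
  interpret pair_graph G by fact
  define n where "n = card (pverts G)"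
  obtain g where g: "bij_betw g {..<n} (pverts G)"
    using ex_bij_betw_nat_finite[OF pair_finite_verts] by (auto simp: n_def atLeast0LessThan)
  define \<phi> where "\<phi> = exists_upto n (diagram G n g)"
  have sent: "sentence \<phi>"
    using free_vars_diagram by (auto simp: sentence_def \<phi>_def free_vars_exists_upto)
  have sat_iff: "true_in H \<phi> \<longleftrightarrow> (\<exists>h. (\<forall>i<n. h i \<in> pverts H) \<and>
      (\<forall>i<n. \<forall>j<n. (h i = h j \<longleftrightarrow> i = j) \<and> ((h i, h j) \<in> parcs H \<longleftrightarrow> (g i, g j) \<in> parcs G)) \<and>
      (\<forall>y\<in>pverts H. \<exists>i<n. y = h i))" for H :: "'b pair_pre_digraph"
    using g unfolding true_in_sentence[OF sent, of H undefined]
    unfolding \<phi>_def sat_exists_upto sat_diagram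
    by (auto simp: bij_betw_def inj_on_def cong: conj_cong)
  have "true_in G \<phi>"
    unfolding sat_iff using g by (intro exI[of _ g]) (auto simp: bij_betw_def inj_on_def)
  moreover have "digraph_iso (with_proj G) (with_proj H)"
    if H: "pair_graph H" "true_in H \<phi>" for H :: "nat pair_pre_digraph"
  proof -
    interpret H: pair_graph H by fact
    obtain h where h: "\<forall>i<n. h i \<in> pverts H"
        "\<forall>i<n. \<forall>j<n. (h i = h j \<longleftrightarrow> i = j) \<and> ((h i, h j) \<in> parcs H \<longleftrightarrow> (g i, g j) \<in> parcs G)"
        "\<forall>y\<in>pverts H. \<exists>i<n. y = h i"
      using H(2) unfolding sat_iff by (elim exE conjE)
    let ?i = "the_inv_into {..<n} g"
    have i: "bij_betw ?i (pverts G) {..<n}" using g by (rule bij_betw_the_inv_into)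
    have h_bij: "bij_betw h {..<n} (pverts H)"
      using h by (auto simp: bij_betw_def inj_on_def)
    have gi: "g (?i u) = u" "?i u < n" if "u \<in> pverts G" for u
      using that f_the_inv_into_f_bij_betw[OF g] bij_betwE[OF i] by auto
    have "(u, w) \<in> parcs G \<longleftrightarrow> ((h \<circ> ?i) u, (h \<circ> ?i) w) \<in> parcs H"
      if "u \<in> pverts G" "w \<in> pverts G" for u w
      using h(2) gi[OF that(1)] gi[OF that(2)] by simp
    then show ?thesis
      by (intro digraph_isoI_pair[OF pair_wf_digraph H.pair_wf_digraph bij_betw_trans[OF i h_bij]])
  qed
  ultimately show ?thesis using sent unfolding defines_graph_def by blast
qed

theorem logical_depth_gt_leaves:
  fixes G :: "nat pair_pre_digraph"
  assumes "pair_graph G" "v \<in> pverts G" "v \<notin> L" "L \<subseteq> pverts G"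
    and "\<And>s y. s \<in> L \<Longrightarrow> (s, y) \<in> parcs G \<longleftrightarrow> y = v"
  shows "card L < logical_depth G"
proof -
  have "\<exists>d \<phi>. defines_graph \<phi> G \<and> quantifier_depth \<phi> = d"
    using ex_defines_graph[OF assms(1)] by blast
  from LeastI_ex[OF this] obtain \<phi> where "defines_graph \<phi> G" "quantifier_depth \<phi> = logical_depth G"
    unfolding logical_depth_def by blast
  then show ?thesis
    using leaf_bundle_quantifier_depth[OF assms(1) leaf_bundleI[OF assms]] by metis
qed

section \<open>Undirected trees and parent functions\<close>

definition parent_graph :: "'a set \<Rightarrow> ('a \<Rightarrow> 'a) \<Rightarrow> 'a pair_pre_digraph" where
  "parent_graph V f = \<lparr>pverts = V, parcs = {(x, y) \<in> V \<times> V. x \<noteq> y \<and> (f x = y \<or> f y = x)}\<rparr>"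

lemma pverts_parent_graph [simp]: "pverts (parent_graph V f) = V"
  by (simp add: parent_graph_def)

lemma parcs_parent_graph:
  "(x, y) \<in> parcs (parent_graph V f) \<longleftrightarrow> x \<in> V \<and> y \<in> V \<and> x \<noteq> y \<and> (f x = y \<or> f y = x)"
  by (auto simp: parent_graph_def)

lemma pair_graph_parent_graph:
  assumes "finite V"
  shows "pair_graph (parent_graph V f)"
proof
  show "finite (parcs (parent_graph V f))"
    by (rule finite_subset[of _ "V \<times> V"]) (use assms in \<open>auto simp: parent_graph_def\<close>)
qed (use assms in \<open>auto simp: parent_graph_def symmetric_def intro: symI\<close>)

lemma connected_pair_graph_iff:
  assumes "pair_graph G"
  shows "Digraph_Component.connected (with_proj G) \<longleftrightarrow>
    pverts G \<noteq> {} \<and> (\<forall>u\<in>pverts G. \<forall>v\<in>pverts G. (u, v) \<in> (parcs G)\<^sup>*)"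
proof -
  interpret pair_graph G by fact
  have "mk_symmetric (with_proj G) = G"
  proof (intro pair_pre_digraph.equality)
    show "parcs (mk_symmetric (with_proj G)) = parcs G"
      using arcs_symmetric by (fastforce simp: parcs_mk_symmetric)
  qed simp_all
  then show ?thesis
    by (auto simp: Digraph_Component.connected_def strongly_connected_def reachable_conv)
qed

lemma roots_unique: "roots V f = {r} \<Longrightarrow> x \<in> V \<Longrightarrow> f x = x \<Longrightarrow> x = r"
  by (auto simp: roots_def)

lemma parent_trees_reach_root:
  assumes "f \<in> parent_trees V" "roots V f = {r}" "x \<in> V"
  shows "\<exists>i. (f ^^ i) x = r"
proof -
  have forest: "f \<in> parent_forests V" using assms(1) by (rule parent_trees_forest)
  obtain i where i: "f ((f ^^ i) x) = (f ^^ i) x" using forest assms(3) by (auto simp: parent_forests_def)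
  show ?thesis
    using roots_unique[OF assms(2) parent_forests_funpow_mem[OF forest assms(3)] i] by blast
qed

lemma pcas_fst_nth_0: "pcas u p v \<Longrightarrow> p \<noteq> [] \<Longrightarrow> fst (p ! 0) = u"
  by (cases p) auto

lemma pcas_snd_nth:
  "pcas u p v \<Longrightarrow> i < length p \<Longrightarrow> snd (p ! i) = (if Suc i < length p then fst (p ! Suc i) else v)"
proof (induction p arbitrary: u i)
  case (Cons e p)
  then show ?case
  proof (cases i)
    case 0
    then show ?thesis using Cons.prems by (cases p) auto
  next
    case (Suc j)
    then show ?thesis using Cons.IH[of "snd e" j] Cons.prems by simp
  qed
qed simp

text \<open>On a cycle, both neighbours of a vertex at maximal distance from the root would be its
  parent.\<close>

lemma parent_graph_no_cycle:
  assumes V: "finite V" and f: "f \<in> parent_trees V"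
    and p: "pre_digraph.cycle (with_proj (parent_graph V f)) p"
  shows "length p < 3"
proof (rule ccontr)
  assume "\<not> length p < 3"
  then have m: "3 \<le> length p" by simp
  define m where "m = length p"
  interpret pair_graph "parent_graph V f" by (rule pair_graph_parent_graph[OF V])
  obtain r where r: "roots V f = {r}" using f by (auto simp: parent_trees_def)
  define depth where "depth = (\<lambda>x. LEAST i. (f ^^ i) x = r)"
  have depth_Suc: "depth x = Suc (depth (f x))" if x: "x \<in> V" "x \<noteq> r" for x
  proof -
    obtain i where "(f ^^ i) x = r" using parent_trees_reach_root[OF f r x(1)] by blast
    then have "(LEAST i. (f ^^ i) x = r) = Suc (LEAST i. (f ^^ Suc i) x = r)"
      by (rule Least_Suc) (use x(2) in simp)
    then show ?thesis unfolding depth_def by (simp only: funpow_Suc_right comp_apply)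
  qed
  have parent: "y = f x" if xy: "(x, y) \<in> parcs (parent_graph V f)" and le: "depth y \<le> depth x" for x y
  proof (rule ccontr)
    assume "y \<noteq> f x"
    then have y: "f y = x" "y \<in> V" "x \<noteq> y" using xy by (auto simp: parcs_parent_graph)
    moreover have "f r = r" using r by (auto simp: roots_def)
    ultimately have "y \<noteq> r" by metis
    then show False using depth_Suc[of y] y le by simp
  qed
  obtain u where u: "awalk u p u" "distinct (tl (awalk_verts u p))" "p \<noteq> []"
    using p unfolding cycle_def by auto
  then have cas: "pcas u p u" and arcs: "set p \<subseteq> parcs (parent_graph V f)"
    unfolding awalk_def by auto
  define succ where "succ i = (if Suc i < m then Suc i else 0)" for i
  define pred where "pred i = (if i = 0 then m - 1 else i - 1)" for i
  have lt: "succ i < m" "pred i < m" "succ (pred i) = i" "succ i \<noteq> pred i" if "i < m" for i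
    using that m by (auto simp: succ_def pred_def m_def)
  have snd_succ: "snd (p ! i) = fst (p ! succ i)" if "i < m" for i
    using pcas_snd_nth[OF cas, of i] pcas_fst_nth_0[OF cas u(3)] that by (simp add: succ_def m_def)
  have "tl (awalk_verts u p) = map snd p"
    using cas awalk_verts_conv'[of u p u] u(3) by simp
  then have dist: "distinct (map snd p)" using u(2) by simp
  have inj: "i = j" if "i < m" "j < m" "snd (p ! i) = snd (p ! j)" for i j
    using dist that by (simp add: m_def distinct_conv_nth) metis
  have arc: "(fst (p ! i), snd (p ! i)) \<in> parcs (parent_graph V f)" if "i < m" for i
    using arcs that by (auto simp: m_def)
  obtain i where i: "i < m" and max: "\<And>j. j < m \<Longrightarrow> depth (snd (p ! j)) \<le> depth (snd (p ! i))"
  proof -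
    have ne: "(\<lambda>i. depth (snd (p ! i))) ` {..<m} \<noteq> {}" using u(3) by (auto simp: m_def)
    have "Max ((\<lambda>i. depth (snd (p ! i))) ` {..<m}) \<in> (\<lambda>i. depth (snd (p ! i))) ` {..<m}"
      by (rule Max_in) (use ne in auto)
    then obtain i where "i < m" "Max ((\<lambda>i. depth (snd (p ! i))) ` {..<m}) = depth (snd (p ! i))" by auto
    then show ?thesis by (intro that[of i]) (auto simp flip: \<open>_ = depth (snd (p ! i))\<close>)
  qed
  have "snd (p ! succ i) = f (snd (p ! i))"
    using parent[OF _ max[OF lt(1)[OF i]]] arc[OF lt(1)[OF i]] snd_succ[OF i] by simp
  moreover have "fst (p ! i) = f (snd (p ! i))"
  proof (rule parent)
    show "(snd (p ! i), fst (p ! i)) \<in> parcs (parent_graph V f)"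
      using arc[OF i] arcs_symmetric by blast
    show "depth (fst (p ! i)) \<le> depth (snd (p ! i))"
      using max[OF lt(2)[OF i]] snd_succ[OF lt(2)[OF i]] lt(3)[OF i] by simp
  qed
  moreover have "fst (p ! i) = snd (p ! pred i)"
    using snd_succ[OF lt(2)[OF i]] lt(3)[OF i] by simp
  ultimately have "succ i = pred i" using inj[OF lt(1)[OF i] lt(2)[OF i]] by simp
  then show False using lt(4)[OF i] by blast
qed

lemma undirected_tree_parent_graph:
  assumes V: "finite V" and f: "f \<in> parent_trees V"
  shows "undirected_tree (parent_graph V f)"
proof -
  let ?G = "parent_graph V f"
  interpret pair_graph ?G by (rule pair_graph_parent_graph[OF V])
  obtain r where r: "roots V f = {r}" using f by (auto simp: parent_trees_def)
  then have "V \<noteq> {}" by (auto simp: roots_def)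
  have step: "(x, f x) \<in> (parcs ?G)\<^sup>*" if "x \<in> V" for x
    using that parent_forests_mem[OF parent_trees_forest[OF f] that]
    by (cases "f x = x") (auto simp: parcs_parent_graph intro!: r_into_rtrancl)
  have "(x, (f ^^ i) x) \<in> (parcs ?G)\<^sup>*" if "x \<in> V" for x i
    using that
  proof (induction i)
    case (Suc i)
    then show ?case
      using step[OF parent_forests_funpow_mem[OF parent_trees_forest[OF f], of x i]]
      by (auto intro: rtrancl_trans)
  qed simp
  then have to_root: "(x, r) \<in> (parcs ?G)\<^sup>*" if "x \<in> V" for x
    using parent_trees_reach_root[OF f r that] that by metis
  have "sym (parcs ?G)" using arcs_symmetric by (auto intro: symI)
  then have "sym ((parcs ?G)\<^sup>*)" by (rule sym_rtrancl)
  then have from_root: "(r, x) \<in> (parcs ?G)\<^sup>*" if "x \<in> V" for x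
    using to_root[OF that] by (auto dest: symD)
  have "Digraph_Component.connected (with_proj ?G)"
    unfolding connected_pair_graph_iff[OF pair_graph]
    using \<open>V \<noteq> {}\<close> to_root from_root by (auto intro: rtrancl_trans)
  then show ?thesis
    using parent_graph_no_cycle[OF V f] pair_graph by (force simp: undirected_tree_def)
qed

lemma parent_graph_inject:
  assumes f: "f \<in> parent_trees V" "roots V f = {r}" and g: "g \<in> parent_trees V" "roots V g = {r}"
    and eq: "parent_graph V f = parent_graph V g"
  shows "f = g"
proof -
  have forest: "f \<in> parent_forests V" "g \<in> parent_forests V"
    using f(1) g(1) by (auto intro: parent_trees_forest)
  have r: "f r = r" "g r = r" using f(2) g(2) by (auto simp: roots_def)
  have step: "f (g x) \<noteq> g (g x)" if x: "x \<in> V" "f x \<noteq> g x" for x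
  proof -
    have gx: "g x \<in> V" "g x \<noteq> x"
      using parent_forests_mem[OF forest(2) x(1)] roots_unique[OF g(2) x(1)] r x(2) by metis+
    then have "(x, g x) \<in> parcs (parent_graph V f)" using x(1) by (simp add: eq parcs_parent_graph)
    then have "f (g x) = x" using x by (auto simp: parcs_parent_graph)
    moreover have "(g ^^ Suc 1) x \<noteq> x" using parent_forests_acyclic[OF forest(2) x(1)] gx(2) by blast
    ultimately show ?thesis by simp
  qed
  have "f x = g x" if x: "x \<in> V" for x
  proof (rule ccontr)
    assume neq: "f x \<noteq> g x"
    have "f ((g ^^ i) x) \<noteq> g ((g ^^ i) x)" for i
    proof (induction i)
      case (Suc i)
      then show ?case using step[OF parent_forests_funpow_mem[OF forest(2) x]] by simp
    qed (use neq in simp)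
    then show False using parent_trees_reach_root[OF g x] r by metis
  qed
  then show ?thesis using forest by (auto simp: parent_forests_def intro: PiE_ext)
qed

lemma spanning_parent_tree_exists:
  assumes "pair_graph G" "Digraph_Component.connected (with_proj G)" "r \<in> pverts G"
  obtains f where "f \<in> parent_trees (pverts G)" "roots (pverts G) f = {r}"
    "\<And>x. x \<in> pverts G \<Longrightarrow> x \<noteq> r \<Longrightarrow> (x, f x) \<in> parcs G"
proof -
  interpret pair_graph G by fact
  let ?V = "pverts G"
  define dist where "dist = (\<lambda>x. LEAST n. (x, r) \<in> parcs G ^^ n)"
  have "\<exists>y. (x, y) \<in> parcs G \<and> dist y < dist x" if x: "x \<in> ?V" "x \<noteq> r" for x
  proof -
    have "(x, r) \<in> (parcs G)\<^sup>*" using assms(2,3) x connected_pair_graph_iff[OF assms(1)] by blast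
    then have "\<exists>n. (x, r) \<in> parcs G ^^ n" by (simp add: rtrancl_power)
    then have path: "(x, r) \<in> parcs G ^^ dist x" unfolding dist_def by (rule LeastI_ex)
    then obtain n where n: "dist x = Suc n" using x(2) by (cases "dist x") auto
    obtain y where y: "(x, y) \<in> parcs G" "(y, r) \<in> parcs G ^^ n"
      using path unfolding n by (meson relpow_Suc_D2)
    have "dist y \<le> n" unfolding dist_def using y(2) by (rule Least_le)
    then show ?thesis using y(1) n by auto
  qed
  then obtain nx where nx: "\<And>x. x \<in> ?V \<Longrightarrow> x \<noteq> r \<Longrightarrow> (x, nx x) \<in> parcs G \<and> dist (nx x) < dist x"
    by metis
  define f where "f = (\<lambda>x. if x = r then r else if x \<in> ?V then nx x else undefined)"
  have f: "(x, f x) \<in> parcs G" "f x \<in> ?V" "dist (f x) < dist x" if "x \<in> ?V" "x \<noteq> r" for x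
    using nx[OF that] that in_arcsD2 by (auto simp: f_def)
  have fr: "f r = r" by (simp add: f_def)
  have "\<exists>i. (f ^^ i) x = r" if "x \<in> ?V" for x
    using that
  proof (induction "dist x" arbitrary: x rule: less_induct)
    case less
    show ?case
    proof (cases "x = r")
      case True
      then show ?thesis by (intro exI[of _ 0]) simp
    next
      case False
      then obtain i where "(f ^^ i) (f x) = r" using less f by blast
      then show ?thesis by (intro exI[of _ "Suc i"]) (simp only: funpow_Suc_right comp_apply)
    qed
  qed
  then have "\<exists>i. f ((f ^^ i) x) = (f ^^ i) x" if "x \<in> ?V" for x
    using that fr by metis
  moreover have "f \<in> ?V \<rightarrow>\<^sub>E ?V"
    using f(2) fr assms(3) by (auto simp: PiE_iff extensional_def) (auto simp: f_def)
  moreover have roots: "roots ?V f = {r}"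
    using f(3) fr assms(3) by (auto simp: roots_def) force
  ultimately have "f \<in> parent_trees ?V" by (auto simp: parent_trees_def parent_forests_def)
  then show ?thesis using roots f(1) by (rule that)
qed

text \<open>An edge outside the spanning tree would close a cycle of length at least three.\<close>

lemma undirected_tree_parent_graph_exists:
  assumes T: "undirected_tree T" and r: "r \<in> pverts T"
  obtains f where "f \<in> parent_trees (pverts T)" "roots (pverts T) f = {r}" "parent_graph (pverts T) f = T"
proof -
  let ?V = "pverts T"
  have pg: "pair_graph T" and conn: "Digraph_Component.connected (with_proj T)"
    and acyclic: "\<And>p. pre_digraph.cycle (with_proj T) p \<Longrightarrow> length p < 3"
    using T by (auto simp: undirected_tree_def not_le)
  interpret T: pair_graph T by (rule pg)
  have V: "finite ?V" by (rule T.pair_finite_verts)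
  obtain f where f: "f \<in> parent_trees ?V" "roots ?V f = {r}"
    and arc: "\<And>x. x \<in> ?V \<Longrightarrow> x \<noteq> r \<Longrightarrow> (x, f x) \<in> parcs T"
    using spanning_parent_tree_exists[OF pg conn r] by blast
  have fr: "f r = r" using f(2) by (auto simp: roots_def)
  let ?H = "parent_graph ?V f"
  interpret H: pair_graph ?H by (rule pair_graph_parent_graph[OF V])
  have sub: "parcs ?H \<subseteq> parcs T"
  proof
    fix e assume "e \<in> parcs ?H"
    then obtain x y where e: "e = (x, y)" "x \<in> ?V" "y \<in> ?V" "x \<noteq> y" "f x = y \<or> f y = x"
      by (cases e) (auto simp: parcs_parent_graph)
    from e(5) show "e \<in> parcs T"
    proof
      assume "f x = y"
      then show ?thesis using arc[OF e(2)] e fr by (cases "x = r") auto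
    next
      assume "f y = x"
      then show ?thesis using T.arcs_symmetric arc[OF e(3)] e fr by (cases "y = r") auto
    qed
  qed
  have "(x, y) \<in> parcs ?H" if xy: "(x, y) \<in> parcs T" for x y
  proof (rule ccontr)
    assume notin: "(x, y) \<notin> parcs ?H"
    have V': "x \<in> ?V" "y \<in> ?V" "x \<noteq> y" using xy T.wellformed' T.no_loops' by auto
    have "(x, y) \<in> (parcs ?H)\<^sup>*"
      using undirected_tree_parent_graph[OF V f(1)] V'
        connected_pair_graph_iff[OF pair_graph_parent_graph[OF V]]
      by (auto simp: undirected_tree_def)
    then have "x \<rightarrow>\<^sup>*\<^bsub>with_proj ?H\<^esub> y"
      using V' H.reachable_conv' by simp
    then obtain p where p: "H.apath x p y" using H.reachable_apath by blast
    then have pH: "set p \<subseteq> parcs ?H" and cas: "pcas x p y" and dist: "distinct (pawalk_verts x p)"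
      unfolding H.apath_def H.awalk_def by auto
    have "p \<noteq> []" using cas V'(3) by auto
    have "length p \<noteq> 1"
    proof
      assume "length p = 1"
      then obtain e where "p = [e]" by (cases p) auto
      then have "p = [(x, y)]" using cas by (cases e) auto
      then show False using pH notin by auto
    qed
    have vs: "pawalk_verts x p = x # map snd p"
      using H.awalk_verts_conv'[of x p y] cas \<open>p \<noteq> []\<close> pcas_fst_nth_0[OF cas]
      by (auto simp: hd_conv_nth)
    have yx: "(y, x) \<in> parcs T" using xy by (rule T.arcs_symmetric)
    have "T.awalk x p y" using V'(1) pH sub cas by (auto simp: T.awalk_def)
    then have "T.awalk x (p @ [(y, x)]) x"
      by (rule T.awalk_appendI) (use yx V' in \<open>auto simp: T.awalk_def\<close>)
    moreover have "tl (pawalk_verts x (p @ [(y, x)])) = map snd p @ [x]"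
      using T.awalk_verts_conv'[of x "p @ [(y, x)]" x] calculation by (auto simp: T.awalk_def)
    then have "distinct (tl (pawalk_verts x (p @ [(y, x)])))" using dist vs by auto
    ultimately have "T.cycle (p @ [(y, x)])" by (auto simp: T.cycle_def)
    then have "length p + 1 < 3" using acyclic by fastforce
    then show False using \<open>p \<noteq> []\<close> \<open>length p \<noteq> 1\<close> by (cases p) auto
  qed
  then have "parcs ?H = parcs T" using sub by auto
  then have "?H = T" by (simp add: parent_graph_def)
  then show ?thesis using f that by blast
qed

lemma card_trees_eq_card_parent_trees:
  assumes V: "finite V"
  shows "card V * card {T. undirected_tree T \<and> pverts T = V \<and> Q T} =
    card {f \<in> parent_trees V. Q (parent_graph V f)}"
proof -
  let ?A = "{f \<in> parent_trees V. Q (parent_graph V f)}"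
  let ?B = "{T. undirected_tree T \<and> pverts T = V \<and> Q T}"
  define F where "F f = (the_elem (roots V f), parent_graph V f)" for f
  have F: "F f = (r, parent_graph V f)" if "roots V f = {r}" for f r
    using that by (simp add: F_def)
  have ex_root: "\<exists>r. roots V f = {r}" if "f \<in> ?A" for f using that by (auto simp: parent_trees_def)
  have "inj_on F ?A"
  proof (rule inj_onI)
    fix f g assume fg: "f \<in> ?A" "g \<in> ?A" "F f = F g"
    obtain r where r: "roots V f = {r}" using ex_root[OF fg(1)] by blast
    obtain r' where r': "roots V g = {r'}" using ex_root[OF fg(2)] by blast
    have eq: "r = r'" "parent_graph V f = parent_graph V g" using fg(3) F[OF r] F[OF r'] by auto
    show "f = g"
      by (rule parent_graph_inject[OF _ r _ _ eq(2)]) (use fg(1,2) r' eq(1) in auto)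
  qed
  moreover have "F ` ?A = V \<times> ?B"
  proof (intro equalityI subsetI)
    fix z assume "z \<in> F ` ?A"
    then obtain f where f: "f \<in> ?A" "z = F f" by blast
    obtain r where r: "roots V f = {r}" using ex_root[OF f(1)] by blast
    then have "r \<in> V" by (auto simp: roots_def)
    then show "z \<in> V \<times> ?B"
      using f F[OF r] undirected_tree_parent_graph[OF V] by auto
  next
    fix z assume "z \<in> V \<times> ?B"
    then obtain r T where z: "z = (r, T)" "r \<in> V" "undirected_tree T" "pverts T = V" "Q T" by auto
    obtain f where "f \<in> parent_trees V" "roots V f = {r}" "parent_graph V f = T"
      using undirected_tree_parent_graph_exists[OF z(3)] z(2,4) by metis
    then show "z \<in> F ` ?A" using F z by (intro image_eqI[of _ _ f]) auto
  qed
  ultimately have "card (V \<times> ?B) = card ?A" using card_image[of F ?A] by simp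
  then show ?thesis by (simp add: card_cartesian_product)
qed

lemma out_degree_parent_graph_le:
  assumes "finite V"
  shows "out_degree (with_proj (parent_graph V f)) v \<le> Suc (card {s \<in> V - {v}. f s = v})"
proof -
  have "out_arcs (with_proj (parent_graph V f)) v \<subseteq> Pair v ` insert (f v) {s \<in> V - {v}. f s = v}"
    by (auto simp: out_arcs_def parent_graph_def)
  then have "out_degree (with_proj (parent_graph V f)) v \<le> card (Pair v ` insert (f v) {s \<in> V - {v}. f s = v})"
    unfolding out_degree_def using assms by (intro card_mono) auto
  also have "\<dots> \<le> Suc (card {s \<in> V - {v}. f s = v})"
    using assms by (subst card_image) (auto simp: inj_on_def card_insert_if)
  finally show ?thesis .
qed

lemma max_degree_parent_graph_le:
  assumes "finite V" "V \<noteq> {}" "\<And>v. v \<in> V \<Longrightarrow> card {s \<in> V - {v}. f s = v} < k"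
  shows "max_degree (parent_graph V f) \<le> k"
  unfolding max_degree_def
proof (rule Max.boundedI)
  fix d assume "d \<in> out_degree (with_proj (parent_graph V f)) ` pverts (parent_graph V f)"
  then obtain v where v: "v \<in> V" "d = out_degree (with_proj (parent_graph V f)) v" by auto
  then show "d \<le> k"
    using out_degree_parent_graph_le[OF assms(1), of f v] assms(3)[OF v(1)] by linarith
qed (use assms in auto)

lemma not_own_leaf_child: "v \<notin> leaf_children V f v"
proof
  assume "v \<in> leaf_children V f v"
  then have "f v = v" "v \<in> V" "v \<notin> f ` V" by (auto simp: leaf_children_def)
  then show False by (metis imageI)
qed

lemma card_leaf_children_le_max_degree:
  assumes V: "finite V" and v: "v \<in> V"
  shows "card (leaf_children V f v) \<le> max_degree (parent_graph V f)"
proof -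
  interpret pair_graph "parent_graph V f" by (rule pair_graph_parent_graph[OF V])
  have "Pair v ` leaf_children V f v \<subseteq> out_arcs (with_proj (parent_graph V f)) v"
    using v not_own_leaf_child[of v V f] by (auto simp: leaf_children_def out_arcs_def parent_graph_def)
  moreover have "finite (out_arcs (with_proj (parent_graph V f)) v)"
    using pair_finite_arcs by (simp add: out_arcs_def)
  ultimately have "card (Pair v ` leaf_children V f v) \<le> out_degree (with_proj (parent_graph V f)) v"
    unfolding out_degree_def by (rule card_mono[rotated])
  also have "card (Pair v ` leaf_children V f v) = card (leaf_children V f v)"
    by (rule card_image) (auto simp: inj_on_def)
  also have "out_degree (with_proj (parent_graph V f)) v \<le> max_degree (parent_graph V f)"
    unfolding max_degree_def using V v by (intro Max_ge) auto
  finally show ?thesis .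
qed

lemma card_leaf_children_less_logical_depth:
  fixes V :: "nat set"
  assumes V: "finite V" and v: "v \<in> V"
  shows "card (leaf_children V f v) < logical_depth (parent_graph V f)"
proof (rule logical_depth_gt_leaves[OF pair_graph_parent_graph[OF V]])
  show "v \<notin> leaf_children V f v" by (rule not_own_leaf_child)
  fix s y assume s: "s \<in> leaf_children V f v"
  then have "s \<noteq> v" using not_own_leaf_child by metis
  then show "(s, y) \<in> parcs (parent_graph V f) \<longleftrightarrow> y = v"
    using s v by (auto simp: leaf_children_def parcs_parent_graph)
qed (use v in \<open>auto simp: leaf_children_def\<close>)

section \<open>Asymptotics\<close>

lemma labelled_trees_eq:
  "labelled_trees n \<inter> {T. Q T} = {T. undirected_tree T \<and> pverts T = {1..n} \<and> Q T}"
  by (auto simp: labelled_trees_def)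

lemma card_labelled_trees_Int:
  "n * card (labelled_trees n \<inter> {T. Q T}) = card {f \<in> parent_trees {1..n}. Q (parent_graph {1..n} f)}"
  using card_trees_eq_card_parent_trees[of "{1..n}" Q] by (simp add: labelled_trees_eq)

lemma finite_nonempty_labelled_trees:
  assumes "n > 0"
  shows "finite (labelled_trees n)" and "labelled_trees n \<noteq> {}"
proof -
  have "n * card (labelled_trees n) = n ^ (n - 1)"
    using card_labelled_trees_Int[of n "\<lambda>_. True"] card_parent_trees[of "{1..n}"] assms by simp
  then have "card (labelled_trees n) > 0" using assms by (cases "card (labelled_trees n)") auto
  then show "finite (labelled_trees n)" "labelled_trees n \<noteq> {}" by (auto simp: card_gt_0_iff)
qed

lemma prob_random_tree_eq:
  assumes "n > 0"
  shows "measure_pmf.prob (random_tree n) {T. Q T} =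
    real (card {f \<in> parent_trees {1..n}. Q (parent_graph {1..n} f)}) / real (card (parent_trees {1..n}))"
proof -
  have "measure_pmf.prob (random_tree n) {T. Q T} =
      real (n * card (labelled_trees n \<inter> {T. Q T})) / real (n * card (labelled_trees n \<inter> {T. True}))"
    using finite_nonempty_labelled_trees[OF assms] assms
    by (simp add: random_tree_def measure_pmf_of_set)
  then show ?thesis unfolding card_labelled_trees_Int by simp
qed

lemma one_minus_ge_exp:
  fixes x :: real
  assumes "0 \<le> x" "x \<le> 1 / 2"
  shows "exp (- 2 * x) \<le> 1 - x"
proof -
  have "x * x \<le> x * (1 / 2)" using assms by (intro mult_left_mono) auto
  then have "- 2 * x \<le> ln (1 - x)"
    using ln_one_minus_pos_lower_bound[OF assms] by (simp add: power2_eq_square)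
  then show ?thesis using assms by (subst (asm) ln_ge_iff) auto
qed

lemma fact_ge_power_exp: "real k ^ k * exp (- real k) \<le> fact k"
proof -
  have "(\<Sum>i\<in>{k}. real k ^ i / fact i) \<le> (\<Sum>i. real k ^ i / fact i)"
    using summable_exp[of "real k"] by (intro sum_le_suminf) (auto simp: field_simps)
  also have "\<dots> = exp (real k)" by (simp add: exp_def divide_inverse mult.commute)
  finally show ?thesis by (simp add: exp_minus field_simps)
qed

lemma power_self_eq_exp: "real k ^ k = exp (real k * ln (real k))"
proof (cases "k = 0")
  case False
  then show ?thesis using exp_of_nat_mult[of k "ln (real k)"] by simp
qed simp

lemma no_leaf_bundle_fraction:
  fixes n k :: nat
  assumes k: "k > 0" "2 * k < n"
  shows "real (card {f \<in> parent_trees {1..n}. \<forall>v\<in>{1..n}. card (leaf_children {1..n} f v) < k}) \<le>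
    real (card (parent_trees {1..n})) *
      (exp (4 * (real k)\<^sup>2 / n) - 1 + 3 * exp (real k * (5 + ln (real k))) / n)"
    (is "real ?B \<le> _ * (?e - 1 + ?c)")
proof -
  define N where "N = real n"
  define x where "x = 1 - real k / N"
  define A where "A = N ^ (n - k - 1)"
  define a where "a = (\<lambda>j. real ((n - j) ^ (n - j - 1)))"
  define p where "p = real (n * (n - 1 choose k))"
  have N: "N > 0" and kN: "real k / N \<le> 1 / 2" and x: "0 < x" "x \<le> 1"
    using k by (auto simp: N_def x_def field_simps)
  have x_exp: "exp (- 2 * (real k / N)) \<le> x"
    unfolding x_def by (rule one_minus_ge_exp) (use kN N in auto)
  have a0: "a 0 = A * N ^ k"
    using k by (simp add: a_def A_def N_def flip: power_add)
  have ak: "a k = A * x ^ (n - k - 1)"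
  proof -
    have "real (n - k) = N * x" using k N by (simp add: N_def x_def field_simps)
    then show ?thesis by (simp add: a_def A_def power_mult_distrib)
  qed
  have ak_pos: "a k > 0" using k by (simp add: a_def)
  have a2k: "a (2 * k) \<le> N ^ (n - 2 * k - 1) * x ^ (2 * (n - 2 * k - 1))"
  proof -
    have "real (n - 2 * k) = N * (1 - 2 * (real k / N))" using k N by (simp add: N_def field_simps)
    also have "\<dots> \<le> N * x\<^sup>2"
      using N by (intro mult_left_mono) (auto simp: x_def power2_diff)
    finally have "real (n - 2 * k) ^ (n - 2 * k - 1) \<le> (N * x\<^sup>2) ^ (n - 2 * k - 1)"
      by (intro power_mono) auto
    then show ?thesis by (simp add: a_def power_mult_distrib power_mult)
  qed
  have off_diagonal: "a 0 * a (2 * k) \<le> ?e * (a k)\<^sup>2"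
  proof -
    have "exp (- 4 * (real k)\<^sup>2 / N) = exp (- 2 * (real k / N)) ^ (2 * k)"
      by (simp add: power2_eq_square field_simps flip: exp_of_nat_mult)
    also have "\<dots> \<le> x ^ (2 * k)" using x_exp by (intro power_mono) auto
    finally have x2k: "exp (- 4 * (real k)\<^sup>2 / N) \<le> x ^ (2 * k)" .
    have "a 0 * a (2 * k) \<le> a 0 * (N ^ (n - 2 * k - 1) * x ^ (2 * (n - 2 * k - 1)))"
      using a2k by (intro mult_left_mono) (simp_all add: a_def)
    also have "\<dots> = A\<^sup>2 * x ^ (2 * (n - 2 * k - 1))"
    proof -
      have "N ^ k * N ^ (n - 2 * k - 1) = A" using k by (simp add: A_def flip: power_add)
      then show ?thesis by (simp add: a0 power2_eq_square mult.assoc mult.left_commute)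
    qed
    also have "\<dots> * exp (- 4 * (real k)\<^sup>2 / N) \<le> A\<^sup>2 * x ^ (2 * (n - 2 * k - 1)) * x ^ (2 * k)"
      using x2k x by (intro mult_left_mono) auto
    also have "\<dots> = (a k)\<^sup>2"
    proof -
      have "2 * (n - 2 * k - 1) + 2 * k = 2 * (n - k - 1)" using k by simp
      then show ?thesis
        by (simp add: ak power_mult_distrib mult.assoc flip: power_add power_mult) (simp add: mult.commute)
    qed
    finally have "a 0 * a (2 * k) * exp (- 4 * (real k)\<^sup>2 / N) \<le> (a k)\<^sup>2"
      by (simp add: mult_right_mono)
    then show ?thesis by (simp add: exp_minus N_def field_simps)
  qed
  have diagonal: "a 0 * (A * (3 * 2 ^ k)) \<le> ?c * p * (a k)\<^sup>2"
  proof -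
    have choose: "N * (N * x / k) ^ k \<le> p"
    proof -
      have "N * x / k \<le> real (n - 1) / k"
        using k N by (intro divide_right_mono) (auto simp: N_def x_def field_simps)
      then have "(N * x / k) ^ k \<le> (real (n - 1) / k) ^ k"
        using N x by (intro power_mono) auto
      also have "\<dots> \<le> real (n - 1 choose k)" using k by (intro binomial_ge_n_over_k_pow_k) simp
      finally show ?thesis using N by (simp add: p_def N_def)
    qed
    have "exp (- 4 * real k) = exp (- 2 * (real k / N)) ^ (2 * n)"
      using N by (simp add: N_def flip: exp_of_nat_mult)
    also have "\<dots> \<le> x ^ (2 * n)" using x_exp by (intro power_mono) auto
    also have "\<dots> \<le> x ^ (k + 2 * (n - k - 1))" using x k by (intro power_decreasing) auto
    finally have "exp (- 4 * real k) \<le> x ^ k * (x ^ (n - k - 1))\<^sup>2"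
      by (simp add: power_add power_mult[symmetric] mult.commute)
    then have "N ^ k * A\<^sup>2 * (N * exp (- 4 * real k)) \<le> N ^ k * A\<^sup>2 * (N * (x ^ k * (x ^ (n - k - 1))\<^sup>2))"
      using N by (intro mult_left_mono) auto
    also have "\<dots> = N * (N * x / k) ^ k * real k ^ k * (a k)\<^sup>2"
      using k by (simp add: ak power_mult_distrib power_divide)
    also have "\<dots> \<le> p * real k ^ k * (a k)\<^sup>2"
      using choose by (intro mult_right_mono) auto
    finally have main: "N ^ k * A\<^sup>2 * N * exp (- 4 * real k) \<le> p * real k ^ k * (a k)\<^sup>2" by simp
    have two: "(2::real) ^ k \<le> exp (real k)"
    proof -
      have "(2::real) ^ k \<le> exp 1 ^ k" using exp_ge_add_one_self[of 1] by (intro power_mono) auto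
      then show ?thesis by (simp flip: exp_of_nat_mult)
    qed
    have "a 0 * (A * (3 * 2 ^ k)) = (N ^ k * A\<^sup>2 * N * exp (- 4 * real k)) * (3 * exp (4 * real k) / N) * 2 ^ k"
      using N by (simp add: a0 power2_eq_square exp_minus field_simps)
    also have "\<dots> \<le> (p * real k ^ k * (a k)\<^sup>2) * (3 * exp (4 * real k) / N) * exp (real k)"
      using N by (intro mult_mono[OF mult_right_mono[OF main] two]) (auto simp: p_def)
    also have "\<dots> = (3 * (exp (real k * ln (real k)) * exp (4 * real k) * exp (real k)) / N) * p * (a k)\<^sup>2"
      by (simp add: power_self_eq_exp)
    also have "exp (real k * ln (real k)) * exp (4 * real k) * exp (real k) = exp (real k * (5 + ln (real k)))"
      by (simp add: algebra_simps flip: exp_add)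
    finally show ?thesis by (simp add: N_def)
  qed
  have p: "p > 0" using k by (simp add: p_def)
  have "real ?B * (p * a k)\<^sup>2 \<le> a 0 * (a 0 * (p\<^sup>2 * a (2 * k) + p * (A * (3 * 2 ^ k))) - (p * a k)\<^sup>2)"
    using card_no_leaf_bundle_le[of "{1..n}" k] k by (simp add: a_def p_def A_def N_def)
  also have "\<dots> = a 0 * (p\<^sup>2 * (a 0 * a (2 * k)) + p * (a 0 * (A * (3 * 2 ^ k))) - (p * a k)\<^sup>2)"
    by (simp add: algebra_simps)
  also have "\<dots> \<le> a 0 * (p\<^sup>2 * (?e * (a k)\<^sup>2) + p * (?c * p * (a k)\<^sup>2) - (p * a k)\<^sup>2)"
    using off_diagonal diagonal p
    by (intro mult_left_mono diff_right_mono add_mono) (auto simp: a_def)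
  also have "\<dots> = (a 0 * (?e - 1 + ?c)) * (p * a k)\<^sup>2"
    by (simp add: algebra_simps power2_eq_square)
  finally have "real ?B \<le> a 0 * (?e - 1 + ?c)"
    using p ak_pos by (simp add: mult_le_cancel_right)
  then show ?thesis using card_parent_trees[of "{1..n}"] k by (simp add: a_def)
qed

lemma prob_random_tree_ge:
  fixes n k m :: nat
  assumes k: "k > 0" "2 * k < n" and m: "m < n"
    and Q: "\<And>T. k \<le> max_degree T \<Longrightarrow> k \<le> logical_depth T \<Longrightarrow> max_degree T \<le> m \<Longrightarrow> Q T"
  shows "measure_pmf.prob (random_tree n) {T. Q T} \<ge>
    1 - (exp (4 * (real k)\<^sup>2 / n) - 1 + 3 * exp (real k * (5 + ln (real k))) / n) - n / fact m"
    (is "_ \<ge> 1 - ?b - _")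
proof -
  let ?V = "{1..n}"
  let ?P = "parent_trees ?V"
  let ?A = "{f \<in> ?P. Q (parent_graph ?V f)}"
  let ?B = "{f \<in> ?P. \<forall>v\<in>?V. card (leaf_children ?V f v) < k}"
  let ?C = "{f \<in> ?P. \<exists>v\<in>?V. m \<le> card {s \<in> ?V - {v}. f s = v}}"
  have fin: "finite ?P" by (rule finite_parent_trees) simp
  have n: "n > 0" using k by simp
  have "f \<in> ?A \<union> ?B \<union> ?C" if f: "f \<in> ?P" for f
  proof (cases "f \<in> ?B \<union> ?C")
    case False
    then obtain v where v: "v \<in> ?V" "k \<le> card (leaf_children ?V f v)" using f by (auto simp: not_less)
    have small: "card {s \<in> ?V - {v}. f s = v} < m" if "v \<in> ?V" for v
      using that False f by (auto simp: not_le)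
    have "max_degree (parent_graph ?V f) \<le> m"
      by (rule max_degree_parent_graph_le) (use small n in auto)
    moreover have "k \<le> max_degree (parent_graph ?V f)"
      using v card_leaf_children_le_max_degree[of ?V v f] by simp
    moreover have "k \<le> logical_depth (parent_graph ?V f)"
      using v card_leaf_children_less_logical_depth[of ?V v f] by simp
    ultimately show ?thesis using Q f by blast
  qed simp
  then have "card ?P \<le> card (?A \<union> ?B \<union> ?C)" using fin by (intro card_mono) auto
  also have "\<dots> \<le> card ?A + card ?B + card ?C"
    by (meson add_le_mono card_Un_le le_refl le_trans)
  finally have "real (card ?P) \<le> real (card ?A) + real (card ?B) + real (card ?C)" by simp
  moreover have "real (card ?B) \<le> real (card ?P) * ?b" by (rule no_leaf_bundle_fraction[OF k])
  moreover have "real (card ?C) \<le> real (card ?P) * (real n / fact m)"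
    using card_many_children_le[of ?V m] m by simp
  ultimately have "real (card ?P) * (1 - ?b - real n / fact m) \<le> real (card ?A)"
    by (simp add: algebra_simps)
  moreover have "real (card ?P) > 0" using card_parent_trees[of ?V] n by simp
  ultimately show ?thesis
    unfolding prob_random_tree_eq[OF n] by (simp add: pos_le_divide_eq mult.commute)
qed

definition degree_scale :: "nat \<Rightarrow> real" where
  "degree_scale n = ln (real n) / ln (ln (real n))"

text \<open>Any slack that tends to \<open>0\<close> more slowly than \<open>ln (ln (ln n)) / ln (ln n)\<close> would do.\<close>

definition slack :: "nat \<Rightarrow> real" where
  "slack n = 1 / sqrt (ln (ln (real n)))"

definition lower_degree :: "nat \<Rightarrow> nat" where
  "lower_degree n = nat \<lfloor>(1 - slack n) * degree_scale n\<rfloor>"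

definition upper_degree :: "nat \<Rightarrow> nat" where
  "upper_degree n = nat \<lceil>(1 + slack n) * degree_scale n\<rceil>"

lemma degree_scale_at_top: "filterlim degree_scale at_top sequentially"
  unfolding degree_scale_def by real_asymp

lemma lower_scale_at_top: "filterlim (\<lambda>n. (1 - slack n) * degree_scale n) at_top sequentially"
  unfolding slack_def degree_scale_def by real_asymp

lemma upper_scale_at_top: "filterlim (\<lambda>n. (1 + slack n) * degree_scale n) at_top sequentially"
  unfolding slack_def degree_scale_def by real_asymp

lemma eventually_upper_scale_less: "eventually (\<lambda>n. (1 + slack n) * degree_scale n + 1 < real n / 2) sequentially"
  unfolding slack_def degree_scale_def by real_asymp

lemma eventually_slack_nonneg: "eventually (\<lambda>n. 0 \<le> slack n) sequentially"
  unfolding slack_def by real_asymp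

lemma lower_degree_asymp: "(\<lambda>n. real (lower_degree n) / degree_scale n) \<longlonglongrightarrow> 1"
proof (rule tendsto_sandwich)
  show "(\<lambda>n. (1 - slack n) - 1 / degree_scale n) \<longlonglongrightarrow> 1" "(\<lambda>n. 1 - slack n) \<longlonglongrightarrow> 1"
    unfolding slack_def degree_scale_def by real_asymp+
  have ev: "eventually (\<lambda>n. degree_scale n > 0 \<and> (1 - slack n) * degree_scale n > 0) sequentially"
    using degree_scale_at_top lower_scale_at_top by (simp add: eventually_conj_iff filterlim_at_top_dense)
  then show "eventually (\<lambda>n. (1 - slack n) - 1 / degree_scale n \<le> real (lower_degree n) / degree_scale n) sequentially"
  proof eventually_elim
    case (elim n)
    have "(1 - slack n) * degree_scale n - 1 \<le> real (lower_degree n)"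
      unfolding lower_degree_def by linarith
    then have "((1 - slack n) * degree_scale n - 1) / degree_scale n \<le> real (lower_degree n) / degree_scale n"
      using elim by (intro divide_right_mono) auto
    then show ?case using elim by (simp add: diff_divide_distrib)
  qed
  show "eventually (\<lambda>n. real (lower_degree n) / degree_scale n \<le> 1 - slack n) sequentially"
    using ev
  proof eventually_elim
    case (elim n)
    then have "real (lower_degree n) \<le> (1 - slack n) * degree_scale n"
      unfolding lower_degree_def by linarith
    then show ?case using elim by (simp add: pos_divide_le_eq)
  qed
qed

lemma upper_degree_asymp: "(\<lambda>n. real (upper_degree n) / degree_scale n) \<longlonglongrightarrow> 1"
proof (rule tendsto_sandwich)
  show "(\<lambda>n. 1 + slack n) \<longlonglongrightarrow> 1" "(\<lambda>n. (1 + slack n) + 1 / degree_scale n) \<longlonglongrightarrow> 1"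
    unfolding slack_def degree_scale_def by real_asymp+
  have ev: "eventually (\<lambda>n. degree_scale n > 0 \<and> (1 + slack n) * degree_scale n > 0) sequentially"
    using degree_scale_at_top upper_scale_at_top by (simp add: eventually_conj_iff filterlim_at_top_dense)
  then show "eventually (\<lambda>n. 1 + slack n \<le> real (upper_degree n) / degree_scale n) sequentially"
  proof eventually_elim
    case (elim n)
    have "(1 + slack n) * degree_scale n \<le> real (upper_degree n)"
      unfolding upper_degree_def by linarith
    then show ?case using elim by (simp add: pos_le_divide_eq)
  qed
  show "eventually (\<lambda>n. real (upper_degree n) / degree_scale n \<le> (1 + slack n) + 1 / degree_scale n) sequentially"
    using ev
  proof eventually_elim
    case (elim n)
    then have "real (upper_degree n) \<le> (1 + slack n) * degree_scale n + 1"
      unfolding upper_degree_def by linarith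
    then have "real (upper_degree n) / degree_scale n \<le> ((1 + slack n) * degree_scale n + 1) / degree_scale n"
      using elim by (intro divide_right_mono) auto
    then show ?case using elim by (simp add: add_divide_distrib)
  qed
qed

lemma eventually_degrees_bounded:
  "eventually (\<lambda>n. 0 < lower_degree n \<and> 2 * lower_degree n < n \<and> 0 < upper_degree n \<and>
    upper_degree n < n \<and> 0 < degree_scale n) sequentially"
proof -
  have "eventually (\<lambda>n. degree_scale n > 0 \<and> (1 - slack n) * degree_scale n > 1 \<and> (1 + slack n) * degree_scale n > 0) sequentially"
    using degree_scale_at_top lower_scale_at_top upper_scale_at_top
    by (simp add: eventually_conj_iff filterlim_at_top_dense)
  then show ?thesis
    using eventually_upper_scale_less eventually_slack_nonneg
  proof eventually_elim
    case (elim n)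
    have "(1 - slack n) * degree_scale n \<le> (1 + slack n) * degree_scale n"
      using elim by (intro mult_right_mono) auto
    then have *: "1 \<le> \<lfloor>(1 - slack n) * degree_scale n\<rfloor>" "2 * \<lfloor>(1 - slack n) * degree_scale n\<rfloor> < int n"
      "0 < \<lceil>(1 + slack n) * degree_scale n\<rceil>" "\<lceil>(1 + slack n) * degree_scale n\<rceil> < int n"
      using elim by linarith+
    then have "int (lower_degree n) = \<lfloor>(1 - slack n) * degree_scale n\<rfloor>" "int (upper_degree n) = \<lceil>(1 + slack n) * degree_scale n\<rceil>"
      unfolding lower_degree_def upper_degree_def by auto
    then show ?case using * elim by linarith
  qed
qed

lemma no_leaf_bundle_bound_tendsto:
  "(\<lambda>n. exp (4 * (real (lower_degree n))\<^sup>2 / n) - 1 +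
      3 * exp (real (lower_degree n) * (5 + ln (real (lower_degree n)))) / n) \<longlonglongrightarrow> 0"
proof (rule tendsto_sandwich[OF _ _ tendsto_const])
  let ?u = "\<lambda>n. (1 - slack n) * degree_scale n"
  show "(\<lambda>n. exp (4 * (?u n)\<^sup>2 / real n) - 1 + 3 * exp (?u n * (5 + ln (?u n))) / real n) \<longlonglongrightarrow> 0"
    unfolding slack_def degree_scale_def by real_asymp
  show "eventually (\<lambda>n. 0 \<le> exp (4 * (real (lower_degree n))\<^sup>2 / n) - 1 +
      3 * exp (real (lower_degree n) * (5 + ln (real (lower_degree n)))) / n) sequentially"
    by (intro always_eventually allI add_nonneg_nonneg) auto
  show "eventually (\<lambda>n. exp (4 * (real (lower_degree n))\<^sup>2 / n) - 1 +
      3 * exp (real (lower_degree n) * (5 + ln (real (lower_degree n)))) / n \<le>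
      exp (4 * (?u n)\<^sup>2 / real n) - 1 + 3 * exp (?u n * (5 + ln (?u n))) / real n) sequentially"
    using eventually_degrees_bounded
  proof eventually_elim
    case (elim n)
    let ?k = "lower_degree n"
    have k: "1 \<le> real ?k" "real ?k \<le> ?u n" using elim unfolding lower_degree_def by linarith+
    have "4 * (real ?k)\<^sup>2 / n \<le> 4 * (?u n)\<^sup>2 / n"
      using k by (intro divide_right_mono mult_left_mono power_mono) auto
    moreover have "real ?k * (5 + ln (real ?k)) \<le> ?u n * (5 + ln (?u n))"
      using k by (intro mult_mono add_left_mono) auto
    ultimately show ?case by (intro add_mono diff_right_mono divide_right_mono) auto
  qed
qed

lemma many_children_bound_tendsto: "(\<lambda>n. real n / fact (upper_degree n)) \<longlonglongrightarrow> 0"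
proof (rule tendsto_sandwich[OF _ _ tendsto_const])
  let ?w = "\<lambda>n. (1 + slack n) * degree_scale n"
  show "(\<lambda>n. real n * exp (- (?w n * (ln (?w n) - 1)))) \<longlonglongrightarrow> 0"
    unfolding slack_def degree_scale_def by real_asymp
  show "eventually (\<lambda>n. 0 \<le> real n / fact (upper_degree n)) sequentially" by simp
  have "eventually (\<lambda>n. exp 1 < ?w n) sequentially"
    using upper_scale_at_top by (simp add: filterlim_at_top_dense)
  then show "eventually (\<lambda>n. real n / fact (upper_degree n) \<le> real n * exp (- (?w n * (ln (?w n) - 1)))) sequentially"
  proof eventually_elim
    case (elim n)
    let ?m = "upper_degree n"
    have w: "0 < ?w n" using elim exp_gt_zero[of "1::real"] by linarith
    have m: "?w n \<le> real ?m" unfolding upper_degree_def by linarith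
    have "1 \<le> ln (?w n)" using elim w by (simp add: ln_ge_iff)
    then have "?w n * (ln (?w n) - 1) \<le> real ?m * (ln (real ?m) - 1)"
      using m w by (intro mult_mono diff_right_mono) auto
    then have "exp (?w n * (ln (?w n) - 1)) \<le> real ?m ^ ?m * exp (- real ?m)"
      by (simp add: power_self_eq_exp algebra_simps flip: exp_add)
    also have "\<dots> \<le> fact ?m" by (rule fact_ge_power_exp)
    finally have "real n / fact ?m \<le> real n / exp (?w n * (ln (?w n) - 1))"
      by (intro divide_left_mono) auto
    then show ?case by (simp add: exp_minus divide_inverse)
  qed
qed

theorem theorem5:
  shows "\<exists>\<epsilon> \<delta> :: nat \<Rightarrow> real. \<epsilon> \<longlonglongrightarrow> 0 \<and> \<delta> \<longlonglongrightarrow> 0 \<and>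
    (\<lambda>n. measure_pmf.prob (random_tree n)
       {T. real (logical_depth T) \<ge> (1 - \<epsilon> n) * real (max_degree T) \<and>
           (\<exists>\<eta>. \<bar>\<eta>\<bar> \<le> \<delta> n \<and>
              (1 - \<epsilon> n) * real (max_degree T) = (1 - \<eta>) * (ln (real n) / ln (ln (real n))))})
      \<longlonglongrightarrow> 1"
proof -
  define k where "k n = real (lower_degree n)" for n
  define m where "m n = real (upper_degree n)" for n
  define \<epsilon> where "\<epsilon> n = 1 - k n / m n" for n
  define \<delta> where "\<delta> n = \<bar>1 - k n / degree_scale n\<bar> + \<bar>1 - k n / m n * (k n / degree_scale n)\<bar>" for n
  let ?Q = "\<lambda>n T. real (logical_depth T) \<ge> (1 - \<epsilon> n) * real (max_degree T) \<and>
           (\<exists>\<eta>. \<bar>\<eta>\<bar> \<le> \<delta> n \<and>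
              (1 - \<epsilon> n) * real (max_degree T) = (1 - \<eta>) * (ln (real n) / ln (ln (real n))))"
  have "(\<lambda>n. (k n / degree_scale n) / (m n / degree_scale n)) \<longlonglongrightarrow> 1"
    using tendsto_divide[OF lower_degree_asymp upper_degree_asymp] unfolding k_def m_def by simp
  then have km: "(\<lambda>n. k n / m n) \<longlonglongrightarrow> 1"
  proof (rule Lim_transform_eventually)
    show "eventually (\<lambda>n. (k n / degree_scale n) / (m n / degree_scale n) = k n / m n) sequentially"
      using eventually_degrees_bounded by eventually_elim simp
  qed
  then have "\<epsilon> \<longlonglongrightarrow> 1 - 1"
    unfolding \<epsilon>_def by (intro tendsto_intros)
  then have \<epsilon>: "\<epsilon> \<longlonglongrightarrow> 0" by simp
  have ks: "(\<lambda>n. k n / degree_scale n) \<longlonglongrightarrow> 1" unfolding k_def by (rule lower_degree_asymp)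
  have "\<delta> \<longlonglongrightarrow> \<bar>1 - 1\<bar> + \<bar>1 - 1 * 1\<bar>"
    unfolding \<delta>_def by (intro tendsto_intros km ks)
  then have \<delta>: "\<delta> \<longlonglongrightarrow> 0" by simp
  have bound: "1 - (exp (4 * (k n)\<^sup>2 / n) - 1 + 3 * exp (k n * (5 + ln (k n))) / n) -
      n / fact (upper_degree n) \<le> measure_pmf.prob (random_tree n) {T. ?Q n T}"
    if "0 < lower_degree n" "2 * lower_degree n < n" "0 < upper_degree n" "upper_degree n < n" "0 < degree_scale n"
    for n
    unfolding k_def
  proof (rule prob_random_tree_ge)
    fix T :: "nat pair_pre_digraph"
    assume T: "lower_degree n \<le> max_degree T" "lower_degree n \<le> logical_depth T" "max_degree T \<le> upper_degree n"
    let ?d = "real (max_degree T)"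
    define y where "y = k n / m n * ?d"
    have pos: "0 < k n" "0 < m n" using that by (simp_all add: k_def m_def)
    have d: "k n \<le> ?d" "?d \<le> m n" using T by (simp_all add: k_def m_def)
    have y: "k n / m n * k n \<le> y" "y \<le> k n"
      using d pos by (auto simp: y_def field_simps)
    have "real (logical_depth T) \<ge> y" using y(2) T(2) by (simp add: k_def)
    moreover have "\<bar>1 - y / degree_scale n\<bar> \<le> \<delta> n"
    proof -
      have "y / degree_scale n \<le> k n / degree_scale n" "k n / m n * k n / degree_scale n \<le> y / degree_scale n"
        by (intro divide_right_mono y order.strict_implies_order that(5))+
      then show ?thesis unfolding \<delta>_def times_divide_eq_right by linarith
    qed
    moreover have "y = (1 - (1 - y / degree_scale n)) * (ln (real n) / ln (ln (real n)))"
      using that(5) by (simp flip: degree_scale_def)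
    ultimately show "?Q n T" unfolding \<epsilon>_def y_def by auto
  qed (use that in auto)
  have "(\<lambda>n. measure_pmf.prob (random_tree n) {T. ?Q n T}) \<longlonglongrightarrow> 1"
  proof (rule tendsto_sandwich)
    have "(\<lambda>n. 1 - (exp (4 * (k n)\<^sup>2 / n) - 1 + 3 * exp (k n * (5 + ln (k n))) / n) -
        n / fact (upper_degree n)) \<longlonglongrightarrow> 1 - 0 - 0"
      unfolding k_def
      by (intro tendsto_diff tendsto_const no_leaf_bundle_bound_tendsto many_children_bound_tendsto)
    then show "(\<lambda>n. 1 - (exp (4 * (k n)\<^sup>2 / n) - 1 + 3 * exp (k n * (5 + ln (k n))) / n) -
        n / fact (upper_degree n)) \<longlonglongrightarrow> 1" by simp
    show "eventually (\<lambda>n. 1 - (exp (4 * (k n)\<^sup>2 / n) - 1 + 3 * exp (k n * (5 + ln (k n))) / n) -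
        n / fact (upper_degree n) \<le> measure_pmf.prob (random_tree n) {T. ?Q n T}) sequentially"
      using eventually_degrees_bounded by eventually_elim (intro bound; simp)
    show "eventually (\<lambda>n. measure_pmf.prob (random_tree n) {T. ?Q n T} \<le> 1) sequentially"
      by simp
  qed (rule tendsto_const)
  then show ?thesis using \<epsilon> \<delta> by blast
qed

end
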